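(* Let $r,s\ge 0$ be integers and let $G_{r,s}\subseteq \operatorname{Aut}(\mathbb{C}^2)$ be the subgroup generated by the two one-parameter subgroups $$L_r=\{(x,y)\mapsto (x+\alpha y^r,\,y) : \alpha\in\mathbb{C}\},\qquad R_s=\{(x,y)\mapsto (x,\,y+\beta x^s) : \beta\in\mathbb{C}\}.$$ Then the action of $G_{r,s}$ on $\mathbb{C}^2$ is generically infinitely transitive if and only if $rs\ge 2$.
   Context: $\operatorname{Aut}(\mathbb{C}^2)$ is the group of polynomial automorphisms of the affine plane. An action of a group $G$ on an algebraic variety $X$ is called generically infinitely transitive if for every positive integer $m$ the diagonal action of $G$ on $X^m=X\times\cdots\times X$ ($m$ times) has a (non-empty) Zariski open orbit. *)

theory Defs
  imports
    Complex_Main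
    "HOL-Analysis.Abstract_Topology"
    "HOL-Algebra.Generated_Groups"
    "HOL-Algebra.Group_Action"
begin

section \<open>Polynomial functions and the Zariski topology\<close>

text \<open>
  The complex algebra generated by a set \<open>c\<close> of coordinate functions.  Since the complex numbers
  are an infinite field, polynomials on an affine space may be identified with polynomial functions.
\<close>

inductive_set polyfuns :: "('a \<Rightarrow> complex) set \<Rightarrow> ('a \<Rightarrow> complex) set"
  for c :: "('a \<Rightarrow> complex) set"
where
  const: "(\<lambda>_. a) \<in> polyfuns c"
| coord: "f \<in> c \<Longrightarrow> f \<in> polyfuns c"
| add: "f \<in> polyfuns c \<Longrightarrow> g \<in> polyfuns c \<Longrightarrow> (\<lambda>p. f p + g p) \<in> polyfuns c"
| mult: "f \<in> polyfuns c \<Longrightarrow> g \<in> polyfuns c \<Longrightarrow> (\<lambda>p. f p * g p) \<in> polyfuns c"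

definition zero_locus :: "'a set \<Rightarrow> ('a \<Rightarrow> complex) set \<Rightarrow> 'a set" where
  "zero_locus X F = {p \<in> X. \<forall>f\<in>F. f p = 0}"

definition zariski :: "'a set \<Rightarrow> ('a \<Rightarrow> complex) set \<Rightarrow> 'a topology" where
  "zariski X c = topology (\<lambda>U. \<exists>F \<subseteq> polyfuns c. U = X - zero_locus X F)"

lemma istopology_zariski: "istopology (\<lambda>U. \<exists>F \<subseteq> polyfuns c. U = X - zero_locus X F)"
  unfolding istopology_def
proof (intro conjI allI impI)
  fix S T
  assume "\<exists>F \<subseteq> polyfuns c. S = X - zero_locus X F" "\<exists>F \<subseteq> polyfuns c. T = X - zero_locus X F"
  then obtain F G where FG: "F \<subseteq> polyfuns c" "S = X - zero_locus X F"
    "G \<subseteq> polyfuns c" "T = X - zero_locus X G" by blast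
  let ?H = "{\<lambda>p. f p * g p | f g. f \<in> F \<and> g \<in> G}"
  have "?H \<subseteq> polyfuns c" using FG by (auto intro: polyfuns.mult)
  moreover have "S \<inter> T = X - zero_locus X ?H"
    using FG by (fastforce simp: zero_locus_def)
  ultimately show "\<exists>F \<subseteq> polyfuns c. S \<inter> T = X - zero_locus X F" by blast
next
  fix K
  assume "\<forall>S\<in>K. \<exists>F \<subseteq> polyfuns c. S = X - zero_locus X F"
  then obtain F where F: "\<And>S. S \<in> K \<Longrightarrow> F S \<subseteq> polyfuns c \<and> S = X - zero_locus X (F S)" by metis
  have "(\<Union>S\<in>K. F S) \<subseteq> polyfuns c" using F by blast
  moreover have "\<Union>K = X - zero_locus X (\<Union>S\<in>K. F S)"
  proof -
    have "\<Union>K = (\<Union>S\<in>K. X - zero_locus X (F S))" using F by blast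
    also have "\<dots> = X - zero_locus X (\<Union>S\<in>K. F S)" by (auto simp: zero_locus_def)
    finally show ?thesis .
  qed
  ultimately show "\<exists>F \<subseteq> polyfuns c. \<Union>K = X - zero_locus X F" by blast
qed

lemma openin_zariski:
  "openin (zariski X c) U \<longleftrightarrow> (\<exists>F \<subseteq> polyfuns c. U = X - zero_locus X F)"
  by (simp add: zariski_def topology_inverse'[OF istopology_zariski])

lemma closedin_zariski:
  "closedin (zariski X c) Z \<longleftrightarrow> (\<exists>F \<subseteq> polyfuns c. Z = zero_locus X F)"
proof -
  have top: "topspace (zariski X c) = X"
  proof
    show "topspace (zariski X c) \<subseteq> X"
      unfolding topspace_def by (auto simp: openin_zariski)
    have "openin (zariski X c) X"
      unfolding openin_zariski
      by (rule exI[of _ "{\<lambda>_. 1}"]) (auto simp: zero_locus_def intro: polyfuns.const)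
    then show "X \<subseteq> topspace (zariski X c)" by (rule openin_subset)
  qed
  have "zero_locus X F \<subseteq> X" for F by (auto simp: zero_locus_def)
  then show ?thesis
    unfolding closedin_def top openin_zariski by (metis double_diff order_refl)
qed


section \<open>The automorphism group of the affine plane\<close>

type_synonym plane = "complex \<times> complex"

definition polynomial_map :: "(plane \<Rightarrow> plane) \<Rightarrow> bool" where
  "polynomial_map f \<longleftrightarrow> fst \<circ> f \<in> polyfuns {fst, snd} \<and> snd \<circ> f \<in> polyfuns {fst, snd}"

definition Aut_plane :: "(plane \<Rightarrow> plane) monoid" where
  "Aut_plane =
    \<lparr>carrier = {f. polynomial_map f \<and> (\<exists>g. polynomial_map g \<and> g \<circ> f = id \<and> f \<circ> g = id)},
     mult = (\<circ>), one = id\<rparr>"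

lemma polyfuns_compose_polynomial_map:
  assumes "h \<in> polyfuns {fst, snd}" "polynomial_map f"
  shows "h \<circ> f \<in> polyfuns {fst, snd}"
  using assms(1)
proof induction
  case (const a)
  then show ?case by (simp add: comp_def polyfuns.const)
next
  case (coord h)
  then show ?case using assms(2) unfolding polynomial_map_def by blast
next
  case (add h k)
  then show ?case using polyfuns.add by (fastforce simp: comp_def)
next
  case (mult h k)
  then show ?case using polyfuns.mult by (fastforce simp: comp_def)
qed

lemma polynomial_map_compose:
  "polynomial_map f \<Longrightarrow> polynomial_map g \<Longrightarrow> polynomial_map (f \<circ> g)"
  using polyfuns_compose_polynomial_map[of "fst \<circ> f" g] polyfuns_compose_polynomial_map[of "snd \<circ> f" g]
  by (simp add: polynomial_map_def comp_assoc)

lemma polynomial_map_id: "polynomial_map id"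
  by (auto simp: polynomial_map_def intro: polyfuns.coord)

lemma group_Aut_plane: "group Aut_plane"
proof (rule groupI)
  fix f g assume "f \<in> carrier Aut_plane" "g \<in> carrier Aut_plane"
  then obtain f' g' where *: "polynomial_map f" "polynomial_map f'" "f' \<circ> f = id" "f \<circ> f' = id"
    "polynomial_map g" "polynomial_map g'" "g' \<circ> g = id" "g \<circ> g' = id"
    by (auto simp: Aut_plane_def)
  have "(g' \<circ> f') \<circ> (f \<circ> g) = id" "(f \<circ> g) \<circ> (g' \<circ> f') = id"
    using * by (metis comp_assoc comp_id)+
  then show "f \<otimes>\<^bsub>Aut_plane\<^esub> g \<in> carrier Aut_plane"
    using * by (auto simp: Aut_plane_def intro!: polynomial_map_compose exI[of _ "g' \<circ> f'"])
next
  fix f assume "f \<in> carrier Aut_plane"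
  then obtain f' where *: "polynomial_map f" "polynomial_map f'" "f' \<circ> f = id" "f \<circ> f' = id"
    by (auto simp: Aut_plane_def)
  then show "\<exists>g\<in>carrier Aut_plane. g \<otimes>\<^bsub>Aut_plane\<^esub> f = \<one>\<^bsub>Aut_plane\<^esub>"
    by (intro bexI[of _ f']) (auto simp: Aut_plane_def)
qed (auto simp: Aut_plane_def polynomial_map_id comp_assoc intro!: exI[of _ id])


section \<open>The groups generated by two shears\<close>

definition L_shears :: "nat \<Rightarrow> (plane \<Rightarrow> plane) set" where
  "L_shears r = {\<lambda>(x, y). (x + \<alpha> * y ^ r, y) | \<alpha>. True}"

definition R_shears :: "nat \<Rightarrow> (plane \<Rightarrow> plane) set" where
  "R_shears s = {\<lambda>(x, y). (x, y + \<beta> * x ^ s) | \<beta>. True}"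

definition G_shears :: "nat \<Rightarrow> nat \<Rightarrow> (plane \<Rightarrow> plane) monoid" where
  "G_shears r s = Aut_plane\<lparr>carrier := generate Aut_plane (L_shears r \<union> R_shears s)\<rparr>"

lemma polyfuns_power: "f \<in> polyfuns c \<Longrightarrow> (\<lambda>p. f p ^ n) \<in> polyfuns c"
  by (induction n) (auto intro: polyfuns.const polyfuns.mult)

lemma L_shears_subset_Aut: "L_shears r \<subseteq> carrier Aut_plane"
proof
  fix f assume "f \<in> L_shears r"
  then obtain a where f: "f = (\<lambda>(x, y). (x + a * y ^ r, y))" by (auto simp: L_shears_def)
  have "polynomial_map (\<lambda>(x, y). (x + b * y ^ r, y))" for b
    by (auto simp: polynomial_map_def comp_def case_prod_beta
        intro!: polyfuns.add polyfuns.mult polyfuns_power intro: polyfuns.const polyfuns.coord)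
  then show "f \<in> carrier Aut_plane"
    by (auto simp: Aut_plane_def f fun_eq_iff intro!: exI[of _ "\<lambda>(x, y). (x + (- a) * y ^ r, y)"])
qed

lemma R_shears_subset_Aut: "R_shears s \<subseteq> carrier Aut_plane"
proof
  fix f assume "f \<in> R_shears s"
  then obtain a where f: "f = (\<lambda>(x, y). (x, y + a * x ^ s))" by (auto simp: R_shears_def)
  have "polynomial_map (\<lambda>(x, y). (x, y + b * x ^ s))" for b
    by (auto simp: polynomial_map_def comp_def case_prod_beta
        intro!: polyfuns.add polyfuns.mult polyfuns_power intro: polyfuns.const polyfuns.coord)
  then show "f \<in> carrier Aut_plane"
    by (auto simp: Aut_plane_def f fun_eq_iff intro!: exI[of _ "\<lambda>(x, y). (x, y + (- a) * x ^ s)"])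
qed

lemma subgroup_G_shears: "subgroup (carrier (G_shears r s)) Aut_plane"
  unfolding G_shears_def
  using group.generate_is_subgroup[OF group_Aut_plane] L_shears_subset_Aut R_shears_subset_Aut
  by simp

lemma group_G_shears: "group (G_shears r s)"
  using group.subgroup_imp_group[OF group_Aut_plane subgroup_G_shears]
  by (simp add: G_shears_def)


section \<open>Generic infinite transitivity\<close>

definition plane_power :: "nat \<Rightarrow> (nat \<Rightarrow> plane) set" where
  "plane_power m = {..<m} \<rightarrow>\<^sub>E UNIV"

text \<open>
  The topology on the power is the Zariski topology of the affine space of dimension \<open>2 * m\<close>,
  not the product of the Zariski topologies of the factors.
\<close>

definition zariski_power :: "nat \<Rightarrow> (nat \<Rightarrow> plane) topology" where
  "zariski_power m =
    zariski (plane_power m) ((\<lambda>i p. fst (p i)) ` {..<m} \<union> (\<lambda>i p. snd (p i)) ` {..<m})"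

definition diagonal_action :: "nat \<Rightarrow> ('g \<Rightarrow> plane \<Rightarrow> plane) \<Rightarrow> 'g \<Rightarrow> (nat \<Rightarrow> plane) \<Rightarrow> nat \<Rightarrow> plane" where
  "diagonal_action m \<phi> g = (\<lambda>p\<in>plane_power m. \<lambda>i\<in>{..<m}. \<phi> g (p i))"

definition generically_infinitely_transitive ::
  "('g, 'b) monoid_scheme \<Rightarrow> ('g \<Rightarrow> plane \<Rightarrow> plane) \<Rightarrow> bool" where
  "generically_infinitely_transitive G \<phi> \<longleftrightarrow>
    (\<forall>m>0. \<exists>p\<in>plane_power m. openin (zariski_power m) (orbit G (diagonal_action m \<phi>) p))"

lemma group_action_diagonal_G_shears:
  "group_action (G_shears r s) (plane_power m) (diagonal_action m (\<lambda>g. g))"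
proof -
  let ?d = "diagonal_action m (\<lambda>g. g) :: (plane \<Rightarrow> plane) \<Rightarrow> _"
  have comp: "?d (f \<circ> g) = compose (plane_power m) (?d f) (?d g)" for f g
    by (auto simp: diagonal_action_def compose_def plane_power_def fun_eq_iff)
  have cancel: "?d g (?d f p) = p" if "g \<circ> f = id" "p \<in> plane_power m" for f g p
  proof -
    have "g (f x) = x" for x using that(1) by (metis comp_apply id_apply)
    with that(2) show ?thesis
      by (auto simp: diagonal_action_def plane_power_def fun_eq_iff PiE_def extensional_def)
  qed
  have closed: "?d f p \<in> plane_power m" if "p \<in> plane_power m" for f p
    using that by (auto simp: diagonal_action_def plane_power_def)
  have bij: "?d f \<in> Bij (plane_power m)" if "f \<in> carrier (G_shears r s)" for f
  proof -
    have "f \<in> carrier Aut_plane"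
      using that subgroup.subset[OF subgroup_G_shears] by blast
    then obtain g where g: "g \<circ> f = id" "f \<circ> g = id" by (auto simp: Aut_plane_def)
    have "bij_betw (?d f) (plane_power m) (plane_power m)"
      by (rule bij_betw_byWitness[where f' = "?d g"]) (use cancel[OF g(1)] cancel[OF g(2)] closed in auto)
    moreover have "?d f \<in> extensional (plane_power m)"
      by (simp add: diagonal_action_def)
    ultimately show ?thesis by (simp add: Bij_def)
  qed
  have "?d \<in> hom (G_shears r s) (BijGroup (plane_power m))"
    using bij comp by (auto simp: hom_def BijGroup_def) (simp add: G_shears_def Aut_plane_def)
  then show ?thesis
    by (intro group_action.intro group_hom.intro group_hom_axioms.intro group_G_shears group_BijGroup)
qed

end

theory Submission
  imports Defs "HOL-Probability.Discrete_Topology"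
begin

text \<open>
  Let \<open>d = r s - 1 \<ge> 1\<close>.  The initial velocities of curves in the group form a vector space of vector
  fields that is stable under conjugation by the group.  Starting from \<open>y\<^sup>r \<partial>\<^sub>x\<close> and \<open>x\<^sup>s \<partial>\<^sub>y\<close>, conjugation
  by shears and extraction of coefficients in the parameters produces all \<open>y\<^bsup>r + k d\<^esup> \<partial>\<^sub>x\<close> and
  \<open>x\<^bsup>s + k d\<^esup> \<partial>\<^sub>y\<close>.  By Lagrange interpolation these span the tangent space of the power at every tuple
  whose \<open>x\<^sub>i\<close>, \<open>y\<^sub>i\<close> are nonzero with distinct \<open>d\<close>-th powers, so by the inverse function theorem the orbit
  of such a generic tuple is a neighbourhood of it in the Euclidean topology.  The set of generic tuples
  is connected, since two of them are joined by a complex line from which finitely many points are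
  removed; hence it lies in one orbit, and this orbit is the union of the Zariski open translates of
  that set.

  If \<open>r s < 2\<close>, a nonconstant polynomial invariant of pairs prevents open orbits: \<open>x\<^sub>1 - x\<^sub>2\<close> if
  \<open>r = 0\<close>, \<open>y\<^sub>1 - y\<^sub>2\<close> if \<open>s = 0\<close>, and \<open>x\<^sub>1 y\<^sub>2 - x\<^sub>2 y\<^sub>1\<close> if \<open>r = s = 1\<close>.
\<close>

section \<open>Strict derivatives\<close>

text \<open>The estimate compares two arbitrary points near \<open>x\<close>, so
  \<open>f - D\<close> is Lipschitz near \<open>x\<close> with any prescribed constant. This lets a
  Newton iteration contract while derivatives are only ever computed at a single point.\<close>

definition strict_deriv ::
  "('a::real_normed_vector \<Rightarrow> 'b::real_normed_vector) \<Rightarrow> ('a \<Rightarrow> 'b) \<Rightarrow> 'a \<Rightarrow> bool" where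
  "strict_deriv f D x \<longleftrightarrow> bounded_linear D \<and>
    (\<forall>e>0. \<exists>d>0. \<forall>u\<in>ball x d. \<forall>v\<in>ball x d. norm (f u - f v - D (u - v)) \<le> e * norm (u - v))"

lemma strict_derivE:
  assumes "strict_deriv f D x" "e > 0"
  obtains d where "d > 0"
    "\<And>u v. dist x u < d \<Longrightarrow> dist x v < d \<Longrightarrow> norm (f u - f v - D (u - v)) \<le> e * norm (u - v)"
  using assms unfolding strict_deriv_def by (auto simp: Ball_def)

lemma strict_deriv_bounded_linear: "bounded_linear f \<Longrightarrow> strict_deriv f f x"
  by (auto simp: strict_deriv_def linear_diff[OF bounded_linear.linear] intro!: exI[of _ 1])

lemma strict_deriv_const: "strict_deriv (\<lambda>_. c) (\<lambda>_. 0) x"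
  by (auto simp: strict_deriv_def intro!: exI[of _ 1])

lemma strict_deriv_Pair:
  assumes "strict_deriv f D x" "strict_deriv g E x"
  shows "strict_deriv (\<lambda>u. (f u, g u)) (\<lambda>u. (D u, E u)) x"
  unfolding strict_deriv_def
proof (intro conjI allI impI)
  show "bounded_linear (\<lambda>u. (D u, E u))"
    using assms by (auto simp: strict_deriv_def intro: bounded_linear_Pair)
next
  fix e :: real assume "e > 0"
  then obtain d1 d2 where d: "d1 > 0" "d2 > 0"
    "\<And>u v. dist x u < d1 \<Longrightarrow> dist x v < d1 \<Longrightarrow> norm (f u - f v - D (u - v)) \<le> e/2 * norm (u - v)"
    "\<And>u v. dist x u < d2 \<Longrightarrow> dist x v < d2 \<Longrightarrow> norm (g u - g v - E (u - v)) \<le> e/2 * norm (u - v)"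
    using strict_derivE[OF assms(1), of "e/2"] strict_derivE[OF assms(2), of "e/2"] by (metis half_gt_zero)
  have "norm ((f u, g u) - (f v, g v) - (D (u - v), E (u - v))) \<le> e * norm (u - v)"
    if "u \<in> ball x (min d1 d2)" "v \<in> ball x (min d1 d2)" for u v
    using norm_Pair_le[of "f u - f v - D (u - v)" "g u - g v - E (u - v)"]
      d(3)[of u v] d(4)[of u v] that by auto
  then show "\<exists>d>0. \<forall>u\<in>ball x d. \<forall>v\<in>ball x d.
      norm ((f u, g u) - (f v, g v) - (D (u - v), E (u - v))) \<le> e * norm (u - v)"
    using d by (intro exI[of _ "min d1 d2"]) auto
qed

text \<open>The error splits into the error of \<open>g\<close> over \<open>f u - f v\<close>,
  controlled because \<open>f\<close> is Lipschitz near \<open>x\<close>, and the image under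
  \<open>E\<close> of the error of \<open>f\<close>.\<close>

lemma strict_deriv_compose:
  assumes f: "strict_deriv f D x" and g: "strict_deriv g E (f x)"
  shows "strict_deriv (\<lambda>u. g (f u)) (\<lambda>u. E (D u)) x"
  unfolding strict_deriv_def
proof (intro conjI allI impI)
  have blD: "bounded_linear D" and blE: "bounded_linear E" using f g by (auto simp: strict_deriv_def)
  show "bounded_linear (\<lambda>u. E (D u))" using bounded_linear_compose[OF blE blD] .
  obtain K where K: "K > 0" "\<And>u. norm (D u) \<le> norm u * K"
    using bounded_linear.pos_bounded[OF blD] by blast
  obtain L where L: "L > 0" "\<And>u. norm (E u) \<le> norm u * L"
    using bounded_linear.pos_bounded[OF blE] by blast
  fix e :: real assume e: "e > 0"
  obtain d1 where d1: "d1 > 0" "\<And>u v. dist (f x) u < d1 \<Longrightarrow> dist (f x) v < d1 \<Longrightarrow>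
      norm (g u - g v - E (u - v)) \<le> e / (2 * (K + 1)) * norm (u - v)"
    using strict_derivE[OF g, of "e / (2 * (K + 1))"] e K by auto
  \<comment> \<open>The bound 1 makes \<open>f\<close> Lipschitz with constant \<open>K + 1\<close>;
    the bound \<open>e / (2 * L)\<close> leaves at most half of \<open>e\<close> once
    \<open>E\<close> is applied.\<close>
  define e2 where "e2 = min 1 (e / (2 * L))"
  obtain d2 where d2: "d2 > 0" "\<And>u v. dist x u < d2 \<Longrightarrow> dist x v < d2 \<Longrightarrow>
      norm (f u - f v - D (u - v)) \<le> e2 * norm (u - v)"
    using strict_derivE[OF f, of e2] e L by (auto simp: e2_def)
  have lip: "norm (f u - f v) \<le> (K + 1) * norm (u - v)" if "dist x u < d2" "dist x v < d2" for u v
  proof -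
    have "norm (f u - f v) \<le> norm (f u - f v - D (u - v)) + norm (D (u - v))"
      using norm_triangle_ineq[of "f u - f v - D (u - v)" "D (u - v)"] by simp
    also have "\<dots> \<le> 1 * norm (u - v) + K * norm (u - v)"
      using d2(2)[OF that] K(2)[of "u - v"] mult_right_mono[of e2 1 "norm (u - v)"]
      by (auto simp: e2_def algebra_simps)
    finally show ?thesis by (simp add: algebra_simps)
  qed
  define d where "d = min d2 (d1 / (K + 1))"
  have d: "d > 0" using d1 d2 K by (simp add: d_def)
  have near: "dist (f x) (f u) < d1" if "dist x u < d" for u
  proof -
    have "dist (f x) (f u) \<le> (K + 1) * dist x u"
      using lip[of x u] that d2 by (auto simp: dist_norm d_def)
    also have "\<dots> < d1" using that K by (auto simp: d_def field_simps)
    finally show ?thesis .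
  qed
  have "norm (g (f u) - g (f v) - E (D (u - v))) \<le> e * norm (u - v)"
    if "u \<in> ball x d" "v \<in> ball x d" for u v
  proof -
    have u: "dist x u < d" "dist x v < d" using that by auto
    then have u2: "dist x u < d2" "dist x v < d2" by (auto simp: d_def)
    have "g (f u) - g (f v) - E (D (u - v))
        = (g (f u) - g (f v) - E (f u - f v)) + E (f u - f v - D (u - v))"
      by (simp add: linear_diff[OF bounded_linear.linear[OF blE]])
    also have "norm \<dots> \<le> e / (2 * (K + 1)) * norm (f u - f v) + norm (f u - f v - D (u - v)) * L"
      by (rule norm_triangle_le) (use d1(2)[OF near near, OF u] L(2) add_mono in blast)
    also have "\<dots> \<le> e / (2 * (K + 1)) * ((K + 1) * norm (u - v)) + (e / (2 * L) * norm (u - v)) * L"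
    proof (intro add_mono mult_left_mono mult_right_mono)
      show "norm (f u - f v - D (u - v)) \<le> e / (2 * L) * norm (u - v)"
        using d2(2)[OF u2] mult_right_mono[of e2 "e / (2 * L)" "norm (u - v)"] by (auto simp: e2_def)
    qed (use lip[OF u2] e K L in auto)
    also have "\<dots> = e * norm (u - v)" using K L by (simp add: field_simps)
    finally show ?thesis .
  qed
  then show "\<exists>d>0. \<forall>u\<in>ball x d. \<forall>v\<in>ball x d.
      norm (g (f u) - g (f v) - E (D (u - v))) \<le> e * norm (u - v)"
    using d by blast
qed

lemma strict_deriv_add:
  assumes "strict_deriv f D x" "strict_deriv g E x"
  shows "strict_deriv (\<lambda>u. f u + g u) (\<lambda>u. D u + E u) x"
proof -
  have "bounded_linear (\<lambda>p::'b \<times> 'b. fst p + snd p)"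
    by (intro bounded_linear_add bounded_linear_fst bounded_linear_snd)
  from strict_deriv_compose[OF strict_deriv_Pair[OF assms] strict_deriv_bounded_linear[OF this]]
  show ?thesis by simp
qed

lemma strict_deriv_mult:
  fixes f g :: "'a::real_normed_vector \<Rightarrow> 'b::real_normed_algebra"
  assumes "strict_deriv f D x" "strict_deriv g E x"
  shows "strict_deriv (\<lambda>u. f u * g u) (\<lambda>u. f x * E u + D u * g x) x"
proof -
  have "strict_deriv (\<lambda>p::'b \<times> 'b. fst p * snd p) (\<lambda>p. a * snd p + fst p * b) (a, b)" for a b
    unfolding strict_deriv_def
  proof (intro conjI allI impI)
    show "bounded_linear (\<lambda>p. a * snd p + fst p * b)"
      by (intro bounded_linear_add bounded_linear_const_mult bounded_linear_mult_const
          bounded_linear_fst bounded_linear_snd)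
  next
    fix e :: real assume e: "e > 0"
    have "norm (fst u * snd u - fst v * snd v - (a * snd (u - v) + fst (u - v) * b)) \<le> e * norm (u - v)"
      if "u \<in> ball (a, b) (e / 2)" "v \<in> ball (a, b) (e / 2)" for u v
    proof -
      have "norm (u - (a, b)) \<le> e / 2" "norm (v - (a, b)) \<le> e / 2"
        using that by (simp_all add: dist_norm norm_minus_commute)
      moreover have fs: "norm (fst w) \<le> norm w" "norm (snd w) \<le> norm w" for w :: "'b \<times> 'b"
        by (metis norm_fst_le prod.collapse, metis norm_snd_le prod.collapse)
      ultimately have "norm (fst u - a) \<le> e / 2" "norm (snd v - b) \<le> e / 2"
        using fs(1)[of "u - (a, b)"] fs(2)[of "v - (a, b)"] by auto
      moreover have "norm (fst u - fst v) \<le> norm (u - v)" "norm (snd u - snd v) \<le> norm (u - v)"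
        using fs[of "u - v"] by auto
      ultimately have "norm ((fst u - a) * (snd u - snd v) + (fst u - fst v) * (snd v - b))
          \<le> e / 2 * norm (u - v) + norm (u - v) * (e / 2)"
        by (intro norm_triangle_le add_mono order.trans[OF norm_mult_ineq] mult_mono) (use e in auto)
      \<comment> \<open>Exact remainder of the product, with the order of factors kept: each summand
        has one factor of norm at most \<open>e / 2\<close>.\<close>
      moreover have "fst u * snd u - fst v * snd v - (a * snd (u - v) + fst (u - v) * b)
          = (fst u - a) * (snd u - snd v) + (fst u - fst v) * (snd v - b)"
        by (simp add: algebra_simps)
      moreover have "e / 2 * norm (u - v) + norm (u - v) * (e / 2) = e * norm (u - v)" by simp
      ultimately show ?thesis by (simp only:)
    qed
    then show "\<exists>d>0. \<forall>u\<in>ball (a, b) d. \<forall>v\<in>ball (a, b) d.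
        norm (fst u * snd u - fst v * snd v - (a * snd (u - v) + fst (u - v) * b)) \<le> e * norm (u - v)"
      using e by (intro exI[of _ "e / 2"]) auto
  qed
  from strict_deriv_compose[OF strict_deriv_Pair[OF assms] this] show ?thesis by simp
qed

lemma strict_deriv_power:
  fixes f :: "'a::real_normed_vector \<Rightarrow> 'b::{real_normed_algebra_1, comm_ring_1}"
  assumes "strict_deriv f D x"
  shows "strict_deriv (\<lambda>u. f u ^ n) (\<lambda>u. of_nat n * f x ^ (n - 1) * D u) x"
proof (induction n)
  case 0
  then show ?case using strict_deriv_const[of 1] by simp
next
  case (Suc n)
  have "f x * (of_nat n * f x ^ (n - 1) * D u) + D u * f x ^ n = of_nat (Suc n) * f x ^ n * D u" for u
    by (cases n) (auto simp: algebra_simps)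
  then show ?case using strict_deriv_mult[OF assms Suc] by simp
qed

text \<open>
  The type of bounded functions on a discrete space serves as a Banach space containing \<open>'b\<^sup>m\<close> for
  every \<open>m\<close>; Newton's iteration is run on functions truncated to the first \<open>m\<close> entries.
\<close>

lemma strict_deriv_local_surj:
  fixes f :: "(nat discrete \<Rightarrow>\<^sub>C 'b::banach) \<Rightarrow> nat \<Rightarrow> 'b"
  assumes "\<And>i. i < m \<Longrightarrow> strict_deriv (\<lambda>w. f w i) (\<lambda>w. apply_bcontfun w (discrete i)) 0"
  shows "\<exists>e>0. \<forall>q. (\<forall>i<m. dist (f 0 i) (q i) < e) \<longrightarrow> (\<exists>w. \<forall>i<m. f w i = q i)"
proof -
  have "\<exists>d>0. \<forall>u v. dist 0 u < d \<longrightarrow> dist 0 v < d \<longrightarrow>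
      norm (f u i - f v i - apply_bcontfun (u - v) (discrete i)) \<le> 1/2 * norm (u - v)" if "i < m" for i
    using strict_derivE[OF assms[OF that], of "1/2"] by (metis half_gt_zero zero_less_one)
  then obtain d where d: "\<And>i. i < m \<Longrightarrow> d i > 0" "\<And>i u v. i < m \<Longrightarrow> norm u < d i \<Longrightarrow> norm v < d i \<Longrightarrow>
      norm (f u i - f v i - apply_bcontfun (u - v) (discrete i)) \<le> 1/2 * norm (u - v)"
    unfolding dist_0_norm by metis
  \<comment> \<open>Halving puts the closed ball of radius \<open>\<delta>\<close> inside every open
    ball of radius \<open>d i\<close>; the element 1 covers \<open>m = 0\<close>.\<close>
  define \<delta> where "\<delta> = Min (insert 1 (d ` {..<m})) / 2"
  have \<delta>: "\<delta> > 0" "\<And>i. i < m \<Longrightarrow> \<delta> < d i"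
  proof -
    have pos: "Min (insert 1 (d ` {..<m})) > 0" using d(1) by (subst Min_gr_iff) auto
    then show "\<delta> > 0" by (simp add: \<delta>_def)
    fix i assume "i < m"
    then have "Min (insert 1 (d ` {..<m})) \<le> d i" by (intro Min_le) auto
    then show "\<delta> < d i" unfolding \<delta>_def using pos by linarith
  qed
  \<comment> \<open>Targets within \<open>\<delta> / 2\<close> give
    \<open>norm (T 0) \<le> \<delta> / 2\<close> below, so the contraction \<open>T\<close> maps the
    closed ball of radius \<open>\<delta>\<close> into itself.\<close>
  have "\<exists>w. \<forall>i<m. f w i = q i" if q: "\<forall>i<m. dist (f 0 i) (q i) < \<delta> / 2" for q
  proof -
    define trunc where "trunc a = Bcontfun (\<lambda>j. if of_discrete j < m then a (of_discrete j) else 0)" for a :: "nat \<Rightarrow> 'b"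
    have trunc: "apply_bcontfun (trunc a) j = (if of_discrete j < m then a (of_discrete j) else 0)" for a j
    proof -
      have "(\<lambda>j. if of_discrete j < m then a (of_discrete j) else 0) \<in> bcontfun"
        by (rule bcontfun_normI[of _ "\<Sum>i<m. norm (a i)"])
          (auto simp: continuous_on_open_vimage open_discrete intro!: sum_nonneg member_le_sum)
      then show ?thesis by (simp add: trunc_def Bcontfun_inverse)
    qed
    \<comment> \<open>Simplified Newton step: the derivative at 0 is the identity on the first
      \<open>m\<close> entries, so no inverse has to be applied, and a fixed point solves
      \<open>f w i = q i\<close>.\<close>
    define T where "T w = trunc (\<lambda>i. apply_bcontfun w (discrete i) - f w i + q i)" for w
    have lip: "norm (T u - T v) \<le> 1/2 * norm (u - v)" if "norm u \<le> \<delta>" "norm v \<le> \<delta>" for u v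
    proof (rule norm_bound)
      fix j :: "nat discrete"
      define i where "i = of_discrete j"
      have j: "j = discrete i" by (simp add: i_def of_discrete_inverse)
      show "norm (apply_bcontfun (T u - T v) j) \<le> 1/2 * norm (u - v)"
      proof (cases "i < m")
        case True
        then have "norm (f u i - f v i - apply_bcontfun (u - v) (discrete i)) \<le> 1/2 * norm (u - v)"
          using d(2)[of i u v] \<delta>(2)[of i] that by auto
        then show ?thesis using True
          by (subst norm_minus_cancel[symmetric]) (simp add: T_def trunc j discrete_inverse algebra_simps)
      qed (simp add: T_def trunc j discrete_inverse)
    qed
    have T0: "norm (T 0) \<le> \<delta> / 2"
      by (rule norm_bound) (use q \<delta> in \<open>auto simp: T_def trunc of_discrete_inverse dist_norm norm_minus_commute less_imp_le\<close>)
    have "\<exists>!w. w \<in> cball 0 \<delta> \<and> T w = w"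
    proof (rule Banach_fix[where c = "1/2"])
      show "complete (cball (0 :: nat discrete \<Rightarrow>\<^sub>C 'b) \<delta>)" 
        by (simp only: complete_eq_closed closed_cball)
      show "T ` cball 0 \<delta> \<subseteq> cball 0 \<delta>"
      proof clarsimp
        fix w :: "nat discrete \<Rightarrow>\<^sub>C 'b" assume w: "norm w \<le> \<delta>"
        have "norm (T w) \<le> norm (T w - T 0) + norm (T 0)"
          using norm_triangle_ineq[of "T w - T 0" "T 0"] by simp
        then show "norm (T w) \<le> \<delta>" using lip[OF w, of 0] T0 w \<delta> by auto
      qed
    qed (use \<delta> lip in \<open>auto simp: dist_norm\<close>)
    then obtain w where w: "T w = w" by blast
    have "f w i = q i" if "i < m" for i
      using arg_cong[OF w, of "\<lambda>w. apply_bcontfun w (discrete i)"] that by (simp add: T_def trunc discrete_inverse)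
    then show ?thesis by blast
  qed
  then show ?thesis using \<delta> by (intro exI[of _ "\<delta> / 2"]) auto
qed

section \<open>Velocity fields of curves in the group\<close>

abbreviation shear1 :: "nat \<Rightarrow> complex \<Rightarrow> plane \<Rightarrow> plane" where
  "shear1 r a \<equiv> \<lambda>(x, y). (x + a * y ^ r, y)"

abbreviation shear2 :: "nat \<Rightarrow> complex \<Rightarrow> plane \<Rightarrow> plane" where
  "shear2 s b \<equiv> \<lambda>(x, y). (x, y + b * x ^ s)"

lemma shear1_Aut: "shear1 r a \<in> carrier Aut_plane"
  by (rule subsetD[OF L_shears_subset_Aut[of r]]) (auto simp: L_shears_def)

lemma shear2_Aut: "shear2 s b \<in> carrier Aut_plane"
  by (rule subsetD[OF R_shears_subset_Aut[of s]]) (auto simp: R_shears_def)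

lemma shear1_mem: "shear1 r a \<in> carrier (G_shears r s)"
  by (auto simp: G_shears_def L_shears_def intro!: generate.incl)

lemma shear2_mem: "shear2 s b \<in> carrier (G_shears r s)"
  by (auto simp: G_shears_def R_shears_def intro!: generate.incl)

lemma id_mem: "id \<in> carrier (G_shears r s)"
  using subgroup.one_closed[OF subgroup_G_shears] by (simp add: Aut_plane_def)

lemma comp_mem:
  "f \<in> carrier (G_shears r s) \<Longrightarrow> g \<in> carrier (G_shears r s) \<Longrightarrow> f \<circ> g \<in> carrier (G_shears r s)"
  using subgroup.m_closed[OF subgroup_G_shears] by (simp add: Aut_plane_def)

lemma inverse_mem:
  assumes "f \<in> carrier (G_shears r s)"
  obtains g where "g \<in> carrier (G_shears r s)" "\<And>p. g (f p) = p" "\<And>p. f (g p) = p"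
proof -
  obtain g where "g \<in> carrier (G_shears r s)" "g \<circ> f = id" "f \<circ> g = id"
    using group.l_inv_ex[OF group_G_shears assms] group.r_inv[OF group_G_shears assms]
      group.l_inv[OF group_G_shears assms] group.inv_closed[OF group_G_shears assms]
    by (auto simp: G_shears_def Aut_plane_def)
  then show thesis using that by (metis comp_apply id_apply)
qed

lemma polynomial_map_mem: "f \<in> carrier (G_shears r s) \<Longrightarrow> polynomial_map f"
  using subgroup.subset[OF subgroup_G_shears] by (auto simp: Aut_plane_def)

text \<open>No case for inverses arises, because the inverse of a shear is the shear with the
  negated parameter.\<close>

lemma G_shears_induct [consumes 1, case_names id shear1 shear2 comp]:
  assumes f: "f \<in> carrier (G_shears r s)"
    and "P id" "\<And>a. P (shear1 r a)" "\<And>b. P (shear2 s b)"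
    and comp: "\<And>f g. P f \<Longrightarrow> P g \<Longrightarrow> P (f \<circ> g)"
  shows "P f"
proof -
  have inv: "inv\<^bsub>Aut_plane\<^esub> g = h" if "g \<in> carrier Aut_plane" "h \<in> carrier Aut_plane" "h \<circ> g = id" for g h
    using group.inv_equality[OF group_Aut_plane _ that(1,2)] that(3) by (simp add: Aut_plane_def)
  have inv1: "inv\<^bsub>Aut_plane\<^esub> (shear1 r a) = shear1 r (- a)" for a
    by (rule inv[OF shear1_Aut shear1_Aut]) auto
  have inv2: "inv\<^bsub>Aut_plane\<^esub> (shear2 s a) = shear2 s (- a)" for a
    by (rule inv[OF shear2_Aut shear2_Aut]) auto
  from f have "f \<in> generate Aut_plane (L_shears r \<union> R_shears s)" by (simp add: G_shears_def)
  then show ?thesis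
  proof induction
    case one
    then show ?case using assms(2) by (simp add: Aut_plane_def id_def)
  next
    case (incl h)
    then show ?case using assms by (auto simp: L_shears_def R_shears_def)
  next
    case (inv h)
    have "P (inv\<^bsub>Aut_plane\<^esub> (shear1 r a))" "P (inv\<^bsub>Aut_plane\<^esub> (shear2 s a))" for a
      unfolding inv1 inv2 by (rule assms)+
    then show ?case using inv by (auto simp: L_shears_def R_shears_def)
  next
    case (eng f g)
    show ?case using comp[OF eng.IH] by (simp add: Aut_plane_def comp_def)
  qed
qed

text \<open>This symmetry lets results about the first coordinate be transferred to the second with
  \<open>r\<close> and \<open>s\<close> exchanged.\<close>

lemma swap_conj_mem:
  assumes "f \<in> carrier (G_shears r s)"
  shows "prod.swap \<circ> f \<circ> prod.swap \<in> carrier (G_shears s r)"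
  using assms
proof (induction rule: G_shears_induct)
  case id
  have "prod.swap \<circ> id \<circ> prod.swap = (id :: plane \<Rightarrow> plane)" by (auto simp: fun_eq_iff)
  then show ?case using id_mem by (simp only:)
next
  case (shear1 a)
  have "prod.swap \<circ> shear1 r a \<circ> prod.swap = shear2 r a" by (auto simp: fun_eq_iff)
  then show ?case using shear2_mem by (simp only:)
next
  case (shear2 b)
  have "prod.swap \<circ> shear2 s b \<circ> prod.swap = shear1 s b" by (auto simp: fun_eq_iff)
  then show ?case using shear1_mem by (simp only:)
next
  case (comp f g)
  have "prod.swap \<circ> (f \<circ> g) \<circ> prod.swap = (prod.swap \<circ> f \<circ> prod.swap) \<circ> (prod.swap \<circ> g \<circ> prod.swap)"
    by (auto simp: fun_eq_iff)
  then show ?case using comp_mem[OF comp] by (simp only:)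
qed

definition smul :: "complex \<Rightarrow> plane \<Rightarrow> plane" where
  "smul c v = (c * fst v, c * snd v)"

lemma smul_simps [simp]:
  "smul c (x, y) = (c * x, c * y)" "fst (smul c v) = c * fst v" "snd (smul c v) = c * snd v"
  "smul 0 v = 0" "smul c 0 = 0" "smul 1 v = v" "smul a (smul b v) = smul (a * b) v"
  by (auto simp: smul_def zero_prod_def)

lemma smul_sum: "smul c (\<Sum>i\<in>A. f i) = (\<Sum>i\<in>A. smul c (f i))"
  by (auto simp: prod_eq_iff fst_sum snd_sum sum_distrib_left)

lemma smul_add: "smul c (u + v) = smul c u + smul c v"
  by (auto simp: prod_eq_iff algebra_simps)

text \<open>
  \<open>V\<close> is the initial velocity of a curve in the group through the identity.  Such fields form a
  complex vector space (compose and reparametrise the curves) that is stable under conjugation.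
\<close>

definition flow_field :: "nat \<Rightarrow> nat \<Rightarrow> (plane \<Rightarrow> plane) \<Rightarrow> bool" where
  "flow_field r s V \<longleftrightarrow> (\<exists>\<psi>. (\<forall>t. \<psi> t \<in> carrier (G_shears r s)) \<and> \<psi> 0 = id \<and>
    (\<forall>p. strict_deriv (\<lambda>u. \<psi> (fst u) (snd u)) (\<lambda>u. smul (fst u) (V p) + snd u) (0, p)))"

lemma flow_fieldE:
  assumes "flow_field r s V"
  obtains \<psi> where "\<And>t. \<psi> t \<in> carrier (G_shears r s)" "\<psi> 0 = id"
    "\<And>p. strict_deriv (\<lambda>u. \<psi> (fst u) (snd u)) (\<lambda>u. smul (fst u) (V p) + snd u) (0, p)"
  using assms unfolding flow_field_def by blast

lemmas strict_deriv_fst = strict_deriv_bounded_linear[OF bounded_linear_fst]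
  and strict_deriv_snd = strict_deriv_bounded_linear[OF bounded_linear_snd]

lemma flow_field_shear1: "flow_field r s (\<lambda>(x, y). (y ^ r, 0))"
  unfolding flow_field_def
proof (intro exI[of _ "shear1 r"] conjI allI shear1_mem)
  fix p :: plane
  have "strict_deriv (\<lambda>u::complex \<times> plane. (fst (snd u) + fst u * snd (snd u) ^ r, snd (snd u)))
     (\<lambda>u. (fst (snd u) + (fst (0, p) * (of_nat r * snd (snd (0::complex, p)) ^ (r - 1) * snd (snd u))
        + fst u * snd (snd (0::complex, p)) ^ r), snd (snd u))) (0, p)"
    by (intro strict_deriv_Pair strict_deriv_add strict_deriv_mult strict_deriv_power
        strict_deriv_compose[OF strict_deriv_snd strict_deriv_fst]
        strict_deriv_compose[OF strict_deriv_snd strict_deriv_snd] strict_deriv_fst)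
  then show "strict_deriv (\<lambda>u. shear1 r (fst u) (snd u))
      (\<lambda>u. smul (fst u) (case p of (x, y) \<Rightarrow> (y ^ r, 0)) + snd u) (0, p)"
    by (simp add: case_prod_beta smul_def plus_prod_def add.commute)
qed (auto simp: fun_eq_iff)

text \<open>The derivative of a curve is taken jointly in time and point, so the chain rule applies
  to \<open>\<phi> t \<circ> \<psi> t\<close>; since \<open>\<psi> 0 = id\<close>, both velocities
  are evaluated at \<open>p\<close>.\<close>

lemma flow_field_add:
  assumes "flow_field r s V" "flow_field r s W"
  shows "flow_field r s (\<lambda>p. V p + W p)"
proof -
  obtain \<phi> where \<phi>: "\<And>t. \<phi> t \<in> carrier (G_shears r s)" "\<phi> 0 = id"
    "\<And>p. strict_deriv (\<lambda>u. \<phi> (fst u) (snd u)) (\<lambda>u. smul (fst u) (V p) + snd u) (0, p)"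
    using assms(1) by (rule flow_fieldE) blast
  obtain \<psi> where \<psi>: "\<And>t. \<psi> t \<in> carrier (G_shears r s)" "\<psi> 0 = id"
    "\<And>p. strict_deriv (\<lambda>u. \<psi> (fst u) (snd u)) (\<lambda>u. smul (fst u) (W p) + snd u) (0, p)"
    using assms(2) by (rule flow_fieldE) blast
  have "strict_deriv (\<lambda>u. (\<phi> (fst u) \<circ> \<psi> (fst u)) (snd u))
      (\<lambda>u. smul (fst u) (V p + W p) + snd u) (0, p)" for p
  proof -
    have "strict_deriv (\<lambda>u. \<phi> (fst u) (snd u)) (\<lambda>u. smul (fst u) (V p) + snd u)
       (fst (0, p), \<psi> (fst (0, p)) (snd (0, p)))"
      using \<phi>(3)[of p] by (simp add: \<psi>(2))
    from strict_deriv_compose[OF strict_deriv_Pair[OF strict_deriv_fst \<psi>(3)] this]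
    show ?thesis by (simp add: smul_add add.assoc)
  qed
  then show ?thesis unfolding flow_field_def
    using \<phi> \<psi> comp_mem by (intro exI[of _ "\<lambda>t. \<phi> t \<circ> \<psi> t"]) auto
qed

lemma flow_field_smul:
  assumes "flow_field r s V"
  shows "flow_field r s (\<lambda>p. smul c (V p))"
proof -
  obtain \<phi> where \<phi>: "\<And>t. \<phi> t \<in> carrier (G_shears r s)" "\<phi> 0 = id"
    "\<And>p. strict_deriv (\<lambda>u. \<phi> (fst u) (snd u)) (\<lambda>u. smul (fst u) (V p) + snd u) (0, p)"
    using assms(1) by (rule flow_fieldE) blast
  have "strict_deriv (\<lambda>u. \<phi> (c * fst u) (snd u)) (\<lambda>u. smul (fst u) (smul c (V p)) + snd u) (0, p)" for p
  proof -
    have "bounded_linear (\<lambda>u::complex \<times> plane. (c * fst u, snd u))"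
      by (intro bounded_linear_Pair bounded_linear_const_mult bounded_linear_fst bounded_linear_snd)
    note 1 = strict_deriv_bounded_linear[OF this, of "(0, p)"]
    have "strict_deriv (\<lambda>u. \<phi> (fst u) (snd u)) (\<lambda>u. smul (fst u) (V p) + snd u)
        (c * fst (0, p), snd (0::complex, p))"
      using \<phi>(3)[of p] by simp
    from strict_deriv_compose[OF 1 this] show ?thesis by (simp add: mult.commute)
  qed
  then show ?thesis unfolding flow_field_def
    using \<phi> by (intro exI[of _ "\<lambda>t. \<phi> (c * t)"]) auto
qed

text \<open>The conjugated curve \<open>g \<circ> \<phi> t \<circ> g'\<close> has the pushforward of
  \<open>V\<close> by \<open>g\<close> as its velocity. The map \<open>g\<close> may lie outside the
  group, which admits the swap besides the shears. The time is complex, hence the complex linearity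
  asked of \<open>D\<close>.\<close>

lemma flow_field_conj:
  assumes V: "flow_field r s V"
    and mem: "\<And>f. f \<in> carrier (G_shears r s) \<Longrightarrow> g \<circ> f \<circ> g' \<in> carrier (G_shears r' s')"
    and inv: "\<And>p. g (g' p) = p"
    and g: "\<And>p. strict_deriv g (D p) p" and g': "\<And>p. strict_deriv g' (D' p) p"
    and D: "\<And>p c v w. D p (smul c v + w) = smul c (D p v) + D p w"
    and DD': "\<And>p v. D (g' p) (D' p v) = v"
  shows "flow_field r' s' (\<lambda>p. D (g' p) (V (g' p)))"
proof -
  obtain \<phi> where \<phi>: "\<And>t. \<phi> t \<in> carrier (G_shears r s)" "\<phi> 0 = id"
    "\<And>p. strict_deriv (\<lambda>u. \<phi> (fst u) (snd u)) (\<lambda>u. smul (fst u) (V p) + snd u) (0, p)"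
    using V by (rule flow_fieldE) blast
  have "strict_deriv (\<lambda>u. (g \<circ> \<phi> (fst u) \<circ> g') (snd u))
      (\<lambda>u. smul (fst u) (D (g' p) (V (g' p))) + snd u) (0, p)" for p
  proof -
    have "strict_deriv g' (D' p) (snd (0::complex, p))" using g' by simp
    note 1 = strict_deriv_Pair[OF strict_deriv_fst strict_deriv_compose[OF strict_deriv_snd this]]
    have "strict_deriv (\<lambda>u. \<phi> (fst u) (snd u)) (\<lambda>u. smul (fst u) (V (g' p)) + snd u)
       (fst (0, p), g' (snd (0::complex, p)))"
      using \<phi>(3) by simp
    note 2 = strict_deriv_compose[OF 1 this]
    have "strict_deriv g (D (g' p)) (\<phi> (fst (fst (0, p), g' (snd (0::complex, p))))
        (snd (fst (0::complex, p), g' (snd (0::complex, p)))))"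
      using g[of "g' p"] by (simp add: \<phi>(2))
    from strict_deriv_compose[OF 2 this] show ?thesis by (simp add: D DD')
  qed
  moreover have "g \<circ> \<phi> 0 \<circ> g' = id" using inv by (auto simp: \<phi>(2))
  ultimately show ?thesis unfolding flow_field_def
    using \<phi>(1) mem by (intro exI[of _ "\<lambda>t. g \<circ> \<phi> t \<circ> g'"]) auto
qed

section \<open>Conjugation by the two shears and by the swap\<close>

lemma strict_deriv_shear1:
  "strict_deriv (shear1 r a) (\<lambda>v. (fst v + a * (of_nat r * snd p ^ (r - 1) * snd v), snd v)) p"
proof -
  have "strict_deriv (\<lambda>u. (fst u + a * snd u ^ r, snd u))
     (\<lambda>v. (fst v + (a * (of_nat r * snd p ^ (r - 1) * snd v) + 0 * snd p ^ r), snd v)) p"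
    by (intro strict_deriv_Pair strict_deriv_add strict_deriv_mult strict_deriv_power
        strict_deriv_snd strict_deriv_fst strict_deriv_const)
  then show ?thesis by (simp add: case_prod_beta')
qed

lemma strict_deriv_shear2:
  "strict_deriv (shear2 s b) (\<lambda>v. (fst v, snd v + b * (of_nat s * fst p ^ (s - 1) * fst v))) p"
proof -
  have "strict_deriv (\<lambda>u. (fst u, snd u + b * fst u ^ s))
     (\<lambda>v. (fst v, snd v + (b * (of_nat s * fst p ^ (s - 1) * fst v) + 0 * fst p ^ s))) p"
    by (intro strict_deriv_Pair strict_deriv_add strict_deriv_mult strict_deriv_power
        strict_deriv_snd strict_deriv_fst strict_deriv_const)
  then show ?thesis by (simp add: case_prod_beta')
qed

lemma flow_field_conj_shear1:
  assumes "flow_field r s (\<lambda>(x, y). (f x y, g x y))"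
  shows "flow_field r s (\<lambda>(x, y). (f (x - a * y ^ r) y
    + a * (of_nat r * y ^ (r - 1) * g (x - a * y ^ r) y), g (x - a * y ^ r) y))"
proof -
  have "flow_field r s (\<lambda>p. (\<lambda>p v. (fst v + a * (of_nat r * snd p ^ (r - 1) * snd v), snd v)) (shear1 r (- a) p)
      (case shear1 r (- a) p of (x, y) \<Rightarrow> (f x y, g x y)))"
    by (rule flow_field_conj[OF assms _ _ strict_deriv_shear1 strict_deriv_shear1])
      (auto intro!: comp_mem shear1_mem shear1_mem[where a = "- a", simplified] simp: algebra_simps split: prod.splits)
  then show ?thesis by (simp add: case_prod_beta')
qed

lemma flow_field_conj_shear2:
  assumes "flow_field r s (\<lambda>(x, y). (f x y, g x y))"
  shows "flow_field r s (\<lambda>(x, y). (f x (y - b * x ^ s),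
    g x (y - b * x ^ s) + b * (of_nat s * x ^ (s - 1) * f x (y - b * x ^ s))))"
proof -
  have "flow_field r s (\<lambda>p. (\<lambda>p v. (fst v, snd v + b * (of_nat s * fst p ^ (s - 1) * fst v))) (shear2 s (- b) p)
      (case shear2 s (- b) p of (x, y) \<Rightarrow> (f x y, g x y)))"
    by (rule flow_field_conj[OF assms _ _ strict_deriv_shear2 strict_deriv_shear2])
      (auto intro!: comp_mem shear2_mem shear2_mem[where b = "- b", simplified] simp: algebra_simps split: prod.splits)
  then show ?thesis by (simp add: case_prod_beta')
qed

lemma flow_field_swap:
  assumes "flow_field r s V"
  shows "flow_field s r (\<lambda>(x, y). prod.swap (V (y, x)))"
proof -
  have bl: "bounded_linear (prod.swap :: plane \<Rightarrow> plane)"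
    unfolding prod.swap_def by (intro bounded_linear_Pair bounded_linear_fst bounded_linear_snd)
  have "flow_field s r (\<lambda>p. (\<lambda>_. prod.swap) (prod.swap p) (V (prod.swap p)))"
    by (rule flow_field_conj[OF assms swap_conj_mem _ strict_deriv_bounded_linear[OF bl]
          strict_deriv_bounded_linear[OF bl]]) (auto simp: prod_eq_iff)
  then show ?thesis by (simp add: case_prod_beta' prod.swap_def)
qed

lemma flow_field_zero: "flow_field r s (\<lambda>_. 0)"
  using flow_field_smul[OF flow_field_shear1, of r s 0] by simp

lemma flow_field_sum:
  assumes "\<And>i. i \<in> A \<Longrightarrow> flow_field r s (V i)"
  shows "flow_field r s (\<lambda>p. \<Sum>i\<in>A. V i p)"
  using assms by (induction A rule: infinite_finite_induct) (auto intro: flow_field_zero flow_field_add)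

text \<open>
  Replacing \<open>F t\<close> by \<open>F (2 * t) - 2 ^ n * F t\<close> removes the top coefficient and rescales the others
  by nonzero factors.
\<close>

lemma flow_field_coeff:
  assumes "\<And>t. flow_field r s (\<lambda>p. \<Sum>j\<le>n. smul (t ^ j) (W j p))" "j \<le> n"
  shows "flow_field r s (W j)"
  using assms
proof (induction n arbitrary: W j)
  case 0
  then show ?case by simp
next
  case (Suc n)
  let ?F = "\<lambda>t p. \<Sum>j\<le>Suc n. smul (t ^ j) (W j p)"
  define c where "c j = (2 ^ j - 2 ^ Suc n :: complex)" for j
  have c: "c j \<noteq> 0" if "j \<le> n" for j
  proof -
    have "(2::nat) ^ j \<noteq> 2 ^ Suc n" using that by (simp del: power_Suc)
    then have "of_nat (2 ^ j) \<noteq> (of_nat (2 ^ Suc n) :: complex)" by (simp only: of_nat_eq_iff not_False_eq_True)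
    then show ?thesis by (simp add: c_def)
  qed
  have "flow_field r s (\<lambda>p. \<Sum>j\<le>n. smul (t ^ j) (smul (c j) (W j p)))" for t
  proof -
    have "flow_field r s (\<lambda>p. ?F (2 * t) p + smul (- (2 ^ Suc n)) (?F t p))"
      by (intro flow_field_add flow_field_smul Suc.prems)
    moreover have "?F (2 * t) p + smul (- (2 ^ Suc n)) (?F t p)
        = (\<Sum>j\<le>n. smul (t ^ j) (smul (c j) (W j p)))" for p
    proof -
      have "?F (2 * t) p + smul (- (2 ^ Suc n)) (?F t p)
          = (\<Sum>j\<le>Suc n. smul (t ^ j) (smul (c j) (W j p)))"
        unfolding smul_sum sum.distrib[symmetric]
        by (intro sum.cong) (auto simp: prod_eq_iff c_def power_mult_distrib algebra_simps)
      then show ?thesis by (simp add: c_def)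
    qed
    ultimately show ?thesis by (simp only:)
  qed
  from Suc.IH[OF this] have *: "flow_field r s (W j)" if "j \<le> n" for j
    using flow_field_smul[of r s "\<lambda>p. smul (c j) (W j p)" "1 / c j"] c[OF that] that by simp
  \<comment> \<open>Once the lower fields are known, subtracting them from the family at
    \<open>t = 1\<close> leaves the top one.\<close>
  have "flow_field r s (\<lambda>p. ?F 1 p + smul (- 1) (\<Sum>j\<le>n. W j p))"
    by (intro flow_field_add flow_field_smul Suc.prems flow_field_sum *) auto
  moreover have "?F 1 p + smul (- 1) (\<Sum>j\<le>n. W j p) = W (Suc n) p" for p
    by (simp add: prod_eq_iff)
  ultimately have "flow_field r s (W (Suc n))" by (simp only:)
  then show ?case using * Suc.prems(2) by (cases "j = Suc n") auto
qed

text \<open>The degree bound is uniform in the point, so the family is a polynomial in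
  \<open>t\<close> whose coefficients are vector fields.\<close>

lemma flow_field_poly_coeff:
  assumes "\<And>t. flow_field r s (\<lambda>(x, y). (poly (P x y) t, poly (Q x y) t))"
    and deg: "\<And>x y. degree (P x y) \<le> n" "\<And>x y. degree (Q x y) \<le> n" and "j \<le> n"
  shows "flow_field r s (\<lambda>(x, y). (coeff (P x y) j, coeff (Q x y) j))"
proof (rule flow_field_coeff[where n = n and W = "\<lambda>j (x, y). (coeff (P x y) j, coeff (Q x y) j)"])
  fix t
  have *: "poly p t = (\<Sum>j\<le>n. t ^ j * coeff p j)" if "degree p \<le> n" for p :: "complex poly"
    unfolding poly_altdef
    by (rule sum.mono_neutral_cong_left) (use that in \<open>auto simp: coeff_eq_0 mult.commute\<close>)
  have "(\<lambda>p. \<Sum>j\<le>n. smul (t ^ j) (case p of (x, y) \<Rightarrow> (coeff (P x y) j, coeff (Q x y) j)))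
    = (\<lambda>(x, y). (poly (P x y) t, poly (Q x y) t))"
    by (auto simp: fun_eq_iff prod_eq_iff fst_sum snd_sum *[OF deg(1)] *[OF deg(2)])
  then show "flow_field r s (\<lambda>p. \<Sum>j\<le>n. smul (t ^ j) (case p of (x, y) \<Rightarrow> (coeff (P x y) j, coeff (Q x y) j)))"
    using assms(1) by simp
qed (use assms in auto)

section \<open>Monomial fields from repeated conjugation\<close>

lemma degree_linear_power_le: "degree ([:a, b:] ^ n) \<le> n"
  for a b :: "'a::comm_semiring_1"
  using order.trans[OF degree_power_le[of "[:a, b:]" n] mult_le_mono1[of _ 1 n]] by simp

lemma flow_field_power_step:
  assumes V: "flow_field r s (\<lambda>(x, y). (y ^ N, 0))" and pos: "N > 0" "r > 0" "s > 0"
  shows "flow_field r s (\<lambda>(x, y). (y ^ (N + (r * s - 1)), 0))"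
proof -
  \<comment> \<open>Conjugating \<open>y\<^sup>N \<partial>\<^sub>x\<close> by the second shear with parameter \<open>b\<close>, the coefficient of \<open>b\<close> is a
    flow field.  Conjugating that by the first shear with parameter \<open>a\<close>, the coefficient of \<open>a\<^sup>s\<close>
    is a nonzero multiple of \<open>y\<^bsup>N + r s - 1\<^esup> \<partial>\<^sub>x\<close>.\<close>
  define l2 where "l2 x y = [:y, - (x ^ s):]" for x y :: complex
  have "flow_field r s (\<lambda>(x, y). (poly (l2 x y ^ N) b,
      poly (pCons 0 (Polynomial.smult (of_nat s * x ^ (s - 1)) (l2 x y ^ N))) b))" for b
    using flow_field_conj_shear2[of r s "\<lambda>x y. y ^ N" "\<lambda>x y. 0" b] V
    by (simp add: l2_def poly_power mult.assoc)
  note F2 = this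
  have deg2: "degree (l2 x y ^ N) \<le> N" for x y
    by (simp only: l2_def degree_linear_power_le)
  have "flow_field r s (\<lambda>(x, y). (coeff (l2 x y ^ N) 1,
      coeff (pCons 0 (Polynomial.smult (of_nat s * x ^ (s - 1)) (l2 x y ^ N))) 1))"
    by (rule flow_field_poly_coeff[OF F2, where n = "Suc N"])
      (auto intro: deg2 le_SucI order.trans[OF degree_pCons_le] order.trans[OF degree_smult_le])
  moreover have "coeff (l2 x y ^ N) 1 = - of_nat N * x ^ s * y ^ (N - 1)" for x y
    using coeff_linear_poly_power[of 1 N y "- (x ^ s)"] pos by (simp add: l2_def)
  moreover have "coeff (l2 x y ^ N) 0 = y ^ N" for x y by (simp add: l2_def coeff_0_power)
  ultimately have V2: "flow_field r s (\<lambda>(x, y). (- of_nat N * x ^ s * y ^ (N - 1), of_nat s * x ^ (s - 1) * y ^ N))"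
    by (simp add: coeff_pCons)

  define l1 where "l1 x y = [:x, - (y ^ r):]" for x y :: complex
  \<comment> \<open>\<open>P\<close> and \<open>Q\<close> are the components, as polynomials in
    \<open>a\<close>, of the field \<open>V2\<close> pushed forward by the first shear;
    \<open>l1\<close> stands for \<open>x - a * y ^ r\<close>.\<close>
  define P where "P x y = Polynomial.smult (- of_nat N * y ^ (N - 1)) (l1 x y ^ s)
     + pCons 0 (Polynomial.smult (of_nat r * y ^ (r - 1) * of_nat s * y ^ N) (l1 x y ^ (s - 1)))" for x y
  define Q where "Q x y = Polynomial.smult (of_nat s * y ^ N) (l1 x y ^ (s - 1))" for x y
  have deg1: "degree (l1 x y ^ k) \<le> k" for x y k
    by (simp only: l1_def degree_linear_power_le)
  have degP: "degree (P x y) \<le> s" for x y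
    unfolding P_def
    by (intro degree_add_le order.trans[OF degree_pCons_le] order.trans[OF degree_smult_le] deg1)
      (use deg1[of x y "s - 1"] pos in \<open>auto intro!: order.trans[OF degree_smult_le] Suc_leI\<close>)
  \<comment> \<open>The strict bound is what removes the second component from the coefficient of
    \<open>a ^ s\<close>.\<close>
  have degQ: "degree (Q x y) < s" for x y
    unfolding Q_def
    by (rule le_less_trans[OF order.trans[OF degree_smult_le deg1]]) (use pos in simp)
  have "flow_field r s (\<lambda>(x, y). (poly (P x y) a, poly (Q x y) a))" for a
    using flow_field_conj_shear1[OF V2, of a]
    by (simp add: P_def Q_def l1_def poly_power algebra_simps)
  then have "flow_field r s (\<lambda>(x, y). (coeff (P x y) s, coeff (Q x y) s))"
    by (rule flow_field_poly_coeff[where n = s]) (use degP degQ in \<open>auto intro: less_imp_le\<close>)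
  moreover have "coeff (Q x y) s = 0" for x y using degQ by (simp add: coeff_eq_0)
  \<comment> \<open>The two leading contributions, \<open>N\<close> and \<open>r * s\<close> up to a
    common sign, reinforce each other and cannot cancel.\<close>
  moreover have "coeff (P x y) s = - ((- 1) ^ s * of_nat (N + r * s)) * y ^ (N + (r * s - 1))" for x y
  proof -
    obtain N' r' s' where [simp]: "N = Suc N'" "r = Suc r'" "s = Suc s'"
      using pos by (auto simp: gr0_conv_Suc)
    have top: "coeff (l1 x y ^ k) k = (- (y ^ r)) ^ k" for k
      using coeff_linear_poly_power[of k k x "- (y ^ r)"] by (simp add: l1_def)
    have "coeff (P x y) s = - of_nat N * y ^ (N - 1) * (- (y ^ r)) ^ s
        + of_nat r * y ^ (r - 1) * of_nat s * y ^ N * (- (y ^ r)) ^ (s - 1)"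
      by (simp add: P_def top del: power_Suc)
    also have "\<dots> = - ((- 1) ^ s * of_nat (N + r * s)) * y ^ (N + (r * s - 1))"
      by (simp add: power_minus[of "y ^ _"] power_minus[of "y * y ^ _"] power_mult[symmetric] power_add
           power_mult_distrib algebra_simps)
    finally show ?thesis .
  qed
  ultimately have "flow_field r s (\<lambda>(x, y). (- ((- 1) ^ s * of_nat (N + r * s)) * y ^ (N + (r * s - 1)), 0))"
    by simp
  \<comment> \<open>The scalar is the reciprocal of the coefficient, as \<open>(- 1) ^ s\<close> is
    its own inverse.\<close>
  from flow_field_smul[OF this, of "- ((- 1) ^ s / of_nat (N + r * s))"] show ?thesis
    using pos by (simp add: case_prod_beta' smul_def flip: power_add mult_2 of_nat_add of_nat_mult)
qed

lemma flow_field_powers: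
  assumes "r > 0" "s > 0"
  shows "flow_field r s (\<lambda>(x, y). (y ^ (r + k * (r * s - 1)), 0))"
proof (induction k)
  case 0
  then show ?case using flow_field_shear1 by simp
next
  case (Suc k)
  have "r + Suc k * d = r + k * d + d" for d by simp
  with flow_field_power_step[OF Suc] assms show ?case by (simp only: add_pos_nonneg)
qed

lemma flow_field_poly:
  assumes "r > 0" "s > 0"
  shows "flow_field r s (\<lambda>(x, y). (y ^ r * poly P (y ^ (r * s - 1)), 0))"
proof -
  have "flow_field r s (\<lambda>p. \<Sum>k\<le>degree P. smul (coeff P k)
      (case p of (x, y) \<Rightarrow> (y ^ (r + k * (r * s - 1)), 0)))"
    by (intro flow_field_sum flow_field_smul flow_field_powers assms)
  moreover have "(\<lambda>p::plane. \<Sum>k\<le>degree P. smul (coeff P k) (case p of (x, y) \<Rightarrow> (y ^ (r + k * (r * s - 1)), 0)))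
      = (\<lambda>(x, y). (y ^ r * poly P (y ^ (r * s - 1)), 0))"
    by (rule ext) (simp add: prod_eq_iff case_prod_beta' fst_sum snd_sum poly_altdef sum_distrib_left power_add
        power_mult[symmetric] mult_ac)
  ultimately show ?thesis by (simp only:)
qed

section \<open>Lagrange interpolation at the points of a tuple\<close>

lemma lagrange_basis_poly:
  fixes z :: "nat \<Rightarrow> 'a::field"
  assumes "inj_on z {..<m}" "j < m"
  obtains P where "poly P (z j) = 1" "\<And>i. i < m \<Longrightarrow> i \<noteq> j \<Longrightarrow> poly P (z i) = 0"
proof -
  define Q where "Q = (\<Prod>k\<in>{..<m} - {j}. [:- z k, 1:])"
  have "poly Q (z j) \<noteq> 0" using assms by (auto simp: Q_def poly_prod inj_on_def)
  moreover have "poly Q (z i) = 0" if "i < m" "i \<noteq> j" for i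
    using that by (auto simp: Q_def poly_prod)
  ultimately show thesis using that[of "smult (1 / poly Q (z j)) Q"] by simp
qed

lemma flow_field_fst_interpolation:
  fixes p :: "nat \<Rightarrow> plane"
  assumes "r > 0" "s > 0" and nz: "\<And>i. i < m \<Longrightarrow> snd (p i) \<noteq> 0"
    and inj: "inj_on (\<lambda>i. snd (p i) ^ (r * s - 1)) {..<m}" and "j < m"
  obtains V where "flow_field r s V" "\<And>i. i < m \<Longrightarrow> V (p i) = (if i = j then (1, 0) else 0)"
proof -
  obtain P where P: "poly P (snd (p j) ^ (r * s - 1)) = 1"
    "\<And>i. i < m \<Longrightarrow> i \<noteq> j \<Longrightarrow> poly P (snd (p i) ^ (r * s - 1)) = 0"
    using lagrange_basis_poly[OF inj \<open>j < m\<close>] by blast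
  \<comment> \<open>Dividing by \<open>snd (p j) ^ r\<close> compensates the factor
    \<open>y ^ r\<close> that every available field carries.\<close>
  let ?P = "smult (1 / snd (p j) ^ r) P"
  show thesis
    by (rule that[OF flow_field_poly[OF assms(1,2), of ?P]])
      (use P nz[OF \<open>j < m\<close>] in \<open>auto simp: case_prod_beta' zero_prod_def\<close>)
qed

text \<open>Swapping coordinates exchanges \<open>r\<close> and \<open>s\<close> and preserves
  \<open>r * s - 1\<close>, so the field for the swapped tuple can be carried back.\<close>

lemma flow_field_snd_interpolation:
  fixes p :: "nat \<Rightarrow> plane"
  assumes "r > 0" "s > 0" and nz: "\<And>i. i < m \<Longrightarrow> fst (p i) \<noteq> 0"
    and inj: "inj_on (\<lambda>i. fst (p i) ^ (r * s - 1)) {..<m}" and "j < m"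
  obtains V where "flow_field r s V" "\<And>i. i < m \<Longrightarrow> V (p i) = (if i = j then (0, 1) else 0)"
proof -
  obtain V where V: "flow_field s r V"
    "\<And>i. i < m \<Longrightarrow> V (prod.swap (p i)) = (if i = j then (1, 0) else 0)"
    using flow_field_fst_interpolation[of s r m "\<lambda>i. prod.swap (p i)" j] assms
    by (auto simp: mult.commute)
  have "prod.swap (V (snd (p i), fst (p i))) = (if i = j then (0, 1) else 0)" if "i < m" for i
    using V(2)[OF that] by (auto simp: prod.swap_def zero_prod_def)
  then show thesis using that[OF flow_field_swap[OF V(1)]] by (simp add: case_prod_beta')
qed

section \<open>Orbits of generic tuples\<close>

text \<open>
  An explicit open condition under which flow fields span the tangent space of the power: fields
  along the first (second) coordinate are interpolated at the distinct values \<open>y\<^sub>i\<^sup>d\<close> (\<open>x\<^sub>i\<^sup>d\<close>), where \<open>d = r * s - 1\<close>.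
\<close>

definition generic_tuple :: "nat \<Rightarrow> nat \<Rightarrow> (nat \<Rightarrow> plane) \<Rightarrow> bool" where
  "generic_tuple d m p \<longleftrightarrow> (\<forall>i<m. fst (p i) \<noteq> 0 \<and> snd (p i) \<noteq> 0) \<and>
    inj_on (\<lambda>i. fst (p i) ^ d) {..<m} \<and> inj_on (\<lambda>i. snd (p i) ^ d) {..<m}"

text \<open>Only entries below \<open>m\<close> are compared, so that tuples such as
  \<open>\<lambda>i. h (p i)\<close> outside \<open>plane_power m\<close> are allowed.\<close>

definition same_orbit :: "nat \<Rightarrow> nat \<Rightarrow> nat \<Rightarrow> (nat \<Rightarrow> plane) \<Rightarrow> (nat \<Rightarrow> plane) \<Rightarrow> bool" where
  "same_orbit r s m p q \<longleftrightarrow> (\<exists>g\<in>carrier (G_shears r s). \<forall>i<m. g (p i) = q i)"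

lemma same_orbit_refl: "same_orbit r s m p p"
  unfolding same_orbit_def by (rule bexI[OF _ id_mem]) simp

lemma same_orbit_sym: "same_orbit r s m p q \<Longrightarrow> same_orbit r s m q p"
  unfolding same_orbit_def by (metis inverse_mem)

lemma same_orbit_trans: "same_orbit r s m p q \<Longrightarrow> same_orbit r s m q u \<Longrightarrow> same_orbit r s m p u"
  unfolding same_orbit_def by (metis comp_mem comp_apply)

lemma bounded_linear_apply_bcontfun: "bounded_linear (\<lambda>w. apply_bcontfun w x)"
  by (rule bounded_linear_intro[where K = 1]) (auto intro: norm_bounded)

text \<open>Composing the curves of all interpolating fields, run for times given by the coordinates
  of \<open>w\<close>, yields a family of group elements that moves \<open>p\<close> with identity
  derivative at \<open>w = 0\<close>; local surjectivity then reaches all nearby tuples.\<close>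

lemma same_orbit_nearby:
  assumes "r > 0" "s > 0" and p: "generic_tuple (r * s - 1) m p"
  shows "\<exists>e>0. \<forall>q. (\<forall>i<m. dist (p i) (q i) < e) \<longrightarrow> same_orbit r s m p q"
proof -
  note w0 = bounded_linear_apply_bcontfun
  \<comment> \<open>Induction on the number \<open>k\<close> of points already given their own two
    parameters; to first order only the points below \<open>k\<close> move.\<close>
  have "\<exists>\<Psi>. (\<forall>w. \<Psi> w \<in> carrier (G_shears r s)) \<and> \<Psi> 0 = id \<and>
      (\<forall>i<m. strict_deriv (\<lambda>w. \<Psi> w (p i)) (\<lambda>w. if i < k then apply_bcontfun w (discrete i) else 0) 0)"
    if "k \<le> m" for k
    using that
  proof (induction k)
    case 0
    show ?case
      by (rule exI[of _ "\<lambda>_. id"], intro conjI allI impI id_mem refl) (simp add: strict_deriv_const)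
  next
    case (Suc k)
    then have "k \<le> m" by simp
    from Suc.IH[OF this]
    obtain \<Psi> where \<Psi>: "\<And>w. \<Psi> w \<in> carrier (G_shears r s)" "\<Psi> 0 = id"
      "\<And>i. i < m \<Longrightarrow> strict_deriv (\<lambda>w. \<Psi> w (p i)) (\<lambda>w. if i < k then apply_bcontfun w (discrete i) else 0) 0"
      by blast
    have k: "k < m" using Suc by simp
    obtain V where V: "flow_field r s V" "\<And>i. i < m \<Longrightarrow> V (p i) = (if i = k then (1, 0) else 0)"
      using flow_field_fst_interpolation[of r s m p k] assms k by (auto simp: generic_tuple_def)
    obtain W where W: "flow_field r s W" "\<And>i. i < m \<Longrightarrow> W (p i) = (if i = k then (0, 1) else 0)"
      using flow_field_snd_interpolation[of r s m p k] assms k by (auto simp: generic_tuple_def)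
    obtain \<phi> where \<phi>: "\<And>t. \<phi> t \<in> carrier (G_shears r s)" "\<phi> 0 = id"
      "\<And>p. strict_deriv (\<lambda>u. \<phi> (fst u) (snd u)) (\<lambda>u. smul (fst u) (V p) + snd u) (0, p)"
      using V(1) by (rule flow_fieldE) blast
    obtain \<psi> where \<psi>: "\<And>t. \<psi> t \<in> carrier (G_shears r s)" "\<psi> 0 = id"
      "\<And>p. strict_deriv (\<lambda>u. \<psi> (fst u) (snd u)) (\<lambda>u. smul (fst u) (W p) + snd u) (0, p)"
      using W(1) by (rule flow_fieldE) blast
    let ?w = "\<lambda>w. apply_bcontfun w (discrete k)"
    \<comment> \<open>All factors are the identity at \<open>w = 0\<close>, so their derivatives add
      up; the two new ones contribute the two coordinates of entry \<open>k\<close>.\<close>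
    define \<Phi> where "\<Phi> w = \<phi> (fst (?w w)) \<circ> (\<psi> (snd (?w w)) \<circ> \<Psi> w)" for w
    have "strict_deriv (\<lambda>w. \<Phi> w (p i)) (\<lambda>w. if i < Suc k then apply_bcontfun w (discrete i) else 0) 0"
      if "i < m" for i
    proof -
      have w: "strict_deriv ?w ?w 0" by (rule strict_deriv_bounded_linear[OF w0])
      note w1 = strict_deriv_compose[OF w strict_deriv_fst]
      note w2 = strict_deriv_compose[OF w strict_deriv_snd]
      have "strict_deriv (\<lambda>u. \<psi> (fst u) (snd u)) (\<lambda>u. smul (fst u) (W (p i)) + snd u)
          (snd (?w 0), \<Psi> 0 (p i))"
        using \<psi>(3)[of "p i"] by (simp add: \<Psi>(2))
      note 1 = strict_deriv_compose[OF strict_deriv_Pair[OF w2 \<Psi>(3)[OF that]] this, unfolded fst_conv snd_conv]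
      have "strict_deriv (\<lambda>u. \<phi> (fst u) (snd u)) (\<lambda>u. smul (fst u) (V (p i)) + snd u)
          (fst (?w 0), \<psi> (snd (?w 0)) (\<Psi> 0 (p i)))"
        using \<phi>(3)[of "p i"] by (simp add: \<Psi>(2) \<psi>(2))
      note 2 = strict_deriv_compose[OF strict_deriv_Pair[OF w1 1] this]
      have "smul (fst (?w w)) (V (p i)) + (smul (snd (?w w)) (W (p i))
            + (if i < k then apply_bcontfun w (discrete i) else 0))
          = (if i < Suc k then apply_bcontfun w (discrete i) else 0)" for w
        using V(2)[OF that] W(2)[OF that] by (auto simp: prod_eq_iff less_Suc_eq)
      with 2 show ?thesis by (simp add: \<Phi>_def)
    qed
    moreover have "\<Phi> w \<in> carrier (G_shears r s)" for w
      unfolding \<Phi>_def by (intro comp_mem \<phi>(1) \<psi>(1) \<Psi>(1))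
    moreover have "\<Phi> 0 = id" by (simp add: \<Phi>_def \<phi>(2) \<psi>(2) \<Psi>(2))
    ultimately show ?case by blast
  qed
  from this[OF order_refl] obtain \<Psi> where \<Psi>: "\<And>w. \<Psi> w \<in> carrier (G_shears r s)" "\<Psi> 0 = id"
    "\<And>i. i < m \<Longrightarrow> strict_deriv (\<lambda>w. \<Psi> w (p i)) (\<lambda>w. apply_bcontfun w (discrete i)) 0"
    by auto
  from strict_deriv_local_surj[of m "\<lambda>w i. \<Psi> w (p i)", OF \<Psi>(3)] show ?thesis
    unfolding same_orbit_def using \<Psi>(1,2) by simp metis
qed

section \<open>Polynomial functions along complex lines of tuples\<close>

definition tuple_coords :: "nat \<Rightarrow> ((nat \<Rightarrow> plane) \<Rightarrow> complex) set" where
  "tuple_coords m = (\<lambda>i p. fst (p i)) ` {..<m} \<union> (\<lambda>i p. snd (p i)) ` {..<m}"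

definition tuple_line :: "(nat \<Rightarrow> plane) \<Rightarrow> (nat \<Rightarrow> plane) \<Rightarrow> complex \<Rightarrow> nat \<Rightarrow> plane" where
  "tuple_line p q z i = (fst (p i) + z * (fst (q i) - fst (p i)), snd (p i) + z * (snd (q i) - snd (p i)))"

lemma tuple_line_0 [simp]: "tuple_line p q 0 = p"
  and tuple_line_1 [simp]: "tuple_line p q 1 = q"
  by (auto simp: tuple_line_def fun_eq_iff)

lemma tuple_line_mem: "p \<in> plane_power m \<Longrightarrow> q \<in> plane_power m \<Longrightarrow> tuple_line p q z \<in> plane_power m"
  by (auto simp: plane_power_def tuple_line_def PiE_def extensional_def)

text \<open>Restricting to a line reduces questions about the power to polynomials in one variable,
  with finitely many roots unless zero.\<close>

lemma polyfuns_tuple_line: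
  assumes "f \<in> polyfuns (tuple_coords m)"
  obtains P where "\<And>z. f (tuple_line p q z) = poly P z"
proof -
  have "\<exists>P. \<forall>z. f (tuple_line p q z) = poly P z"
    using assms
  proof induction
    case (const a)
    show ?case by (rule exI[of _ "[:a:]"]) simp
  next
    case (coord f)
    then consider i where "f = (\<lambda>p. fst (p i))" | i where "f = (\<lambda>p. snd (p i))"
      by (auto simp: tuple_coords_def)
    then show ?case
    proof cases
      case (1 i)
      then show ?thesis
        by (intro exI[of _ "[:fst (p i), fst (q i) - fst (p i):]"]) (simp add: tuple_line_def)
    next
      case (2 i)
      then show ?thesis
        by (intro exI[of _ "[:snd (p i), snd (q i) - snd (p i):]"]) (simp add: tuple_line_def)
    qed
  next
    case (add f g)
    then show ?case by (metis poly_add)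
  next
    case (mult f g)
    then show ?case by (metis poly_mult)
  qed
  then show thesis using that by blast
qed

lemma polyfuns_diff: "f \<in> polyfuns c \<Longrightarrow> g \<in> polyfuns c \<Longrightarrow> (\<lambda>p. f p - g p) \<in> polyfuns c"
  using polyfuns.add[of f c "\<lambda>p. (-1) * g p"] polyfuns.mult[OF polyfuns.const[of "-1" c], of g] by simp

lemma polyfuns_prod:
  "(\<And>i. i \<in> A \<Longrightarrow> f i \<in> polyfuns c) \<Longrightarrow> (\<lambda>p. \<Prod>i\<in>A. f i p) \<in> polyfuns c"
  by (induction A rule: infinite_finite_induct) (auto intro: polyfuns.const polyfuns.mult)

lemma polyfuns_compose:
  assumes "f \<in> polyfuns c" "\<And>h. h \<in> c \<Longrightarrow> (\<lambda>p. h (\<phi> p)) \<in> polyfuns c'"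
  shows "(\<lambda>p. f (\<phi> p)) \<in> polyfuns c'"
  using assms(1) by induction (auto intro: polyfuns.intros assms(2))

text \<open>Multiplying everything that must be nonzero gives one polynomial, used both for
  connectedness and for Zariski openness.\<close>

lemma generic_tuple_polyfun:
  obtains D where "D \<in> polyfuns (tuple_coords m)" "\<And>p. generic_tuple d m p \<longleftrightarrow> D p \<noteq> 0"
proof
  let ?D = "\<lambda>p::nat \<Rightarrow> plane. (\<Prod>i<m. fst (p i) * snd (p i)) *
    (\<Prod>i<m. \<Prod>k\<in>{..<m} - {i}. (fst (p i) ^ d - fst (p k) ^ d) * (snd (p i) ^ d - snd (p k) ^ d))"
  show "?D \<in> polyfuns (tuple_coords m)"
    by (intro polyfuns.mult polyfuns_prod polyfuns_diff polyfuns_power polyfuns.coord)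
      (auto simp: tuple_coords_def)
  show "generic_tuple d m p \<longleftrightarrow> ?D p \<noteq> 0" for p
    by (auto simp: generic_tuple_def inj_on_def)
qed

lemma same_orbit_generic:
  assumes "r > 0" "s > 0" and p: "generic_tuple (r * s - 1) m p" and q: "generic_tuple (r * s - 1) m q"
  shows "same_orbit r s m p q"
proof -
  obtain D where D: "D \<in> polyfuns (tuple_coords m)" "\<And>p. generic_tuple (r * s - 1) m p \<longleftrightarrow> D p \<noteq> 0"
    using generic_tuple_polyfun by blast
  obtain P where P: "\<And>z. D (tuple_line p q z) = poly P z" using polyfuns_tuple_line[OF D(1), of p q] by blast
  define S where "S = - {z. poly P z = 0}"
  have S: "z \<in> S \<longleftrightarrow> generic_tuple (r * s - 1) m (tuple_line p q z)" for z
    unfolding S_def D(2) P by simp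
  have 01: "0 \<in> S" "1 \<in> S" using p q by (simp_all add: S)
  then have "P \<noteq> 0" by (auto simp: S_def)
  then have "connected S" unfolding S_def
    by (intro path_connected_imp_connected path_connected_complement_countable)
      (auto intro: countable_finite poly_roots_finite)
  then have "same_orbit r s m (tuple_line p q 0) (tuple_line p q 1)"
    using 01
  \<comment> \<open>On the connected set \<open>S\<close> it remains to see that the orbit is
    locally constant along the line.\<close>
  proof (rule connected_equivalence_relation)
    fix a assume "a \<in> S"
    then obtain e where e: "e > 0"
      "\<And>q'. (\<forall>i<m. dist (tuple_line p q a i) (q' i) < e) \<Longrightarrow> same_orbit r s m (tuple_line p q a) q'"
      using same_orbit_nearby[OF assms(1,2)] S by blast
    have "\<forall>\<^sub>F z in nhds a. dist (tuple_line p q z i) (tuple_line p q a i) < e" for i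
    proof (rule tendstoD[OF tendsto_at_iff_tendsto_nhds[THEN iffD1] e(1)])
      show "((\<lambda>z. tuple_line p q z i) \<longlongrightarrow> tuple_line p q a i) (at a)"
        unfolding tuple_line_def by (intro tendsto_intros)
    qed
    then have "\<forall>\<^sub>F z in nhds a. \<forall>i\<in>{..<m}. dist (tuple_line p q z i) (tuple_line p q a i) < e"
      by (intro eventually_ball_finite) auto
    then obtain U where "open U" "a \<in> U"
      "\<And>z. z \<in> U \<Longrightarrow> \<forall>i<m. dist (tuple_line p q a i) (tuple_line p q z i) < e"
      by (auto simp: eventually_nhds dist_commute)
    then show "\<exists>T. openin (top_of_set S) T \<and> a \<in> T \<and>
        (\<forall>z\<in>T. same_orbit r s m (tuple_line p q a) (tuple_line p q z))"
      using e(2) \<open>a \<in> S\<close> by (intro exI[of _ "S \<inter> U"]) (auto intro: openin_open_Int)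
  qed (blast intro: same_orbit_sym same_orbit_trans)+
  then show ?thesis by simp
qed

section \<open>Zariski openness of the orbits\<close>

lemma mem_orbit_diagonal:
  assumes "p \<in> plane_power m"
  shows "q \<in> orbit (G_shears r s) (diagonal_action m (\<lambda>g. g)) p \<longleftrightarrow>
    q \<in> plane_power m \<and> same_orbit r s m p q"
proof -
  have "q = (\<lambda>i\<in>{..<m}. g (p i)) \<longleftrightarrow> q \<in> plane_power m \<and> (\<forall>i<m. g (p i) = q i)" for g
    by (auto simp: plane_power_def PiE_def extensional_def fun_eq_iff split: if_splits)
  then show ?thesis
    using assms by (simp add: orbit_def same_orbit_def diagonal_action_def) blast
qed

lemma openin_zariski_power:
  "openin (zariski_power m) U \<longleftrightarrow> (\<exists>F \<subseteq> polyfuns (tuple_coords m). U = plane_power m - zero_locus (plane_power m) F)"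
  by (simp add: zariski_power_def openin_zariski tuple_coords_def)

text \<open>Around \<open>q\<close>, the image of \<open>p\<close> under \<open>g\<close>, the
  neighbourhood is the translate by \<open>g\<close> of the generic set. It is the preimage of that
  set under the polynomial inverse \<open>h\<close>, hence open, and each of its points is the
  \<open>g\<close>-image of a generic tuple.\<close>

lemma open_orbit_generic:
  assumes "r > 0" "s > 0" and p: "p \<in> plane_power m" "generic_tuple (r * s - 1) m p"
  shows "openin (zariski_power m) (orbit (G_shears r s) (diagonal_action m (\<lambda>g. g)) p)"
    (is "openin _ ?O")
proof (subst openin_subopen, intro ballI)
  fix q assume "q \<in> ?O"
  then obtain g where g: "g \<in> carrier (G_shears r s)" "\<forall>i<m. g (p i) = q i" and q: "q \<in> plane_power m"
    using p by (auto simp: mem_orbit_diagonal same_orbit_def)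
  obtain h where h: "h \<in> carrier (G_shears r s)" "\<And>x. h (g x) = x" "\<And>x. g (h x) = x"
    using inverse_mem[OF g(1)] by blast
  obtain D where D: "D \<in> polyfuns (tuple_coords m)" "\<And>p. generic_tuple (r * s - 1) m p \<longleftrightarrow> D p \<noteq> 0"
    using generic_tuple_polyfun by blast
  have "(\<lambda>q. D (\<lambda>i. h (q i))) \<in> polyfuns (tuple_coords m)"
  proof (rule polyfuns_compose[OF D(1)])
    have h': "(\<lambda>x. fst (h x)) \<in> polyfuns {fst, snd}" "(\<lambda>x. snd (h x)) \<in> polyfuns {fst, snd}"
      using polynomial_map_mem[OF h(1)] by (simp_all add: polynomial_map_def comp_def)
    have "(\<lambda>p. f (p i)) \<in> polyfuns (tuple_coords m)" if "f \<in> polyfuns {fst, snd}" "i < m" for f i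
      by (rule polyfuns_compose[OF that(1)])
        (use that(2) in \<open>auto simp: tuple_coords_def intro!: polyfuns.coord\<close>)
    from this[OF h'(1)] this[OF h'(2)] show "(\<lambda>p. f (\<lambda>i. h (p i))) \<in> polyfuns (tuple_coords m)" if "f \<in> tuple_coords m" for f
      using that by (auto simp: tuple_coords_def)
  qed
  then have U: "openin (zariski_power m) {q \<in> plane_power m. generic_tuple (r * s - 1) m (\<lambda>i. h (q i))}"
    unfolding openin_zariski_power D(2)
    by (intro exI[of _ "{\<lambda>q. D (\<lambda>i. h (q i))}"]) (auto simp: zero_locus_def)
  \<comment> \<open>Genericity reads only entries below \<open>m\<close>, where
    \<open>h (q i)\<close> equals \<open>p i\<close>; beyond them the tuples may differ.\<close>
  have gen: "generic_tuple (r * s - 1) m u \<longleftrightarrow> generic_tuple (r * s - 1) m v" if "\<forall>i<m. u i = v i" for u v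
    using that by (auto simp: generic_tuple_def inj_on_def)
  have "u \<in> ?O" if u: "u \<in> plane_power m" "generic_tuple (r * s - 1) m (\<lambda>i. h (u i))" for u
  proof -
    have "same_orbit r s m p (\<lambda>i. h (u i))" by (rule same_orbit_generic) (use assms u in auto)
    moreover have "same_orbit r s m (\<lambda>i. h (u i)) u" 
      unfolding same_orbit_def using g(1) h(3) by (intro bexI[of _ g]) simp_all
    ultimately show ?thesis using u p by (auto simp: mem_orbit_diagonal intro: same_orbit_trans)
  qed
  moreover have "generic_tuple (r * s - 1) m (\<lambda>i. h (q i))"
    using gen[of p "\<lambda>i. h (q i)"] p g(2) h(2) by (metis)
  ultimately show "\<exists>T. openin (zariski_power m) T \<and> q \<in> T \<and> T \<subseteq> ?O"
    using U q by blast
qed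

lemma generically_infinitely_transitive_shears:
  assumes "r * s \<ge> 2"
  shows "generically_infinitely_transitive (G_shears r s) (\<lambda>g. g)"
  unfolding generically_infinitely_transitive_def
proof (intro allI impI)
  fix m :: nat
  have rs: "r > 0" "s > 0" using assms by (auto intro!: Nat.gr0I)
  \<comment> \<open>Distinct positive integers have distinct powers, as the exponent
    \<open>r * s - 1\<close> is positive; \<open>Suc\<close> avoids the entry 0.\<close>
  let ?p = "\<lambda>i\<in>{..<m}. (of_nat (Suc i), of_nat (Suc i)) :: plane"
  have "?p \<in> plane_power m" by (auto simp: plane_power_def)
  moreover have "generic_tuple (r * s - 1) m ?p"
  proof -
    have "i = j" if "(of_nat (Suc i) :: complex) ^ (r * s - 1) = of_nat (Suc j) ^ (r * s - 1)" for i j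
    proof -
      have "Suc i ^ (r * s - 1) = Suc j ^ (r * s - 1)"
        using that by (simp only: of_nat_eq_iff flip: of_nat_power)
      then show ?thesis using assms power_eq_iff_eq_base[of "r * s - 1" "Suc i" "Suc j"] by simp
    qed
    then show ?thesis by (auto simp: generic_tuple_def inj_on_def simp del: of_nat_Suc)
  qed
  ultimately show "\<exists>p\<in>plane_power m. openin (zariski_power m) (orbit (G_shears r s) (diagonal_action m (\<lambda>g. g)) p)"
    using open_orbit_generic[OF rs] by blast
qed

section \<open>Invariants of pairs\<close>

text \<open>An open orbit contains a nonempty set where some polynomial \<open>f\<close> is nonzero,
  and \<open>J\<close> is constant there. So \<open>f\<close> times \<open>J - J p0\<close> vanishes
  identically, although on a suitable line through \<open>p0\<close> neither factor does.\<close>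

lemma not_generically_infinitely_transitive_if_invariant:
  assumes J: "J \<in> polyfuns (tuple_coords m)" "m > 0"
    and nonconst: "p \<in> plane_power m" "q \<in> plane_power m" "J p \<noteq> J q"
    and inv1: "\<And>a p. J (\<lambda>i. shear1 r a (p i)) = J p"
    and inv2: "\<And>b p. J (\<lambda>i. shear2 s b (p i)) = J p"
  shows "\<not> generically_infinitely_transitive (G_shears r s) (\<lambda>g. g)"
proof
  assume "generically_infinitely_transitive (G_shears r s) (\<lambda>g. g)"
  have inv: "J (\<lambda>i. f (p i)) = J p" if "f \<in> carrier (G_shears r s)" for f p
    using that
  proof (induction arbitrary: p rule: G_shears_induct)
    case (comp f g)
    then show ?case using comp(1)[of "\<lambda>i. g (p i)"] by simp
  qed (simp_all add: inv1 inv2)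
  from \<open>generically_infinitely_transitive (G_shears r s) (\<lambda>g. g)\<close>
  obtain p0 where p0: "p0 \<in> plane_power m"
    "openin (zariski_power m) (orbit (G_shears r s) (diagonal_action m (\<lambda>g. g)) p0)"
    using \<open>m > 0\<close> unfolding generically_infinitely_transitive_def by blast
  then obtain F where F: "F \<subseteq> polyfuns (tuple_coords m)"
    "orbit (G_shears r s) (diagonal_action m (\<lambda>g. g)) p0 = plane_power m - zero_locus (plane_power m) F"
    by (auto simp: openin_zariski_power)
  have "p0 \<in> orbit (G_shears r s) (diagonal_action m (\<lambda>g. g)) p0"
    using p0(1) by (simp add: mem_orbit_diagonal same_orbit_refl)
  then obtain f where f: "f \<in> F" "f p0 \<noteq> 0" unfolding F(2) using p0(1) by (auto simp: zero_locus_def)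
  have "J u = J p0" if "u \<in> plane_power m" "f u \<noteq> 0" for u
  proof -
    have "u \<in> orbit (G_shears r s) (diagonal_action m (\<lambda>g. g)) p0"
      unfolding F(2) using that f by (auto simp: zero_locus_def)
    then obtain g where g: "g \<in> carrier (G_shears r s)" "\<forall>i<m. g (p0 i) = u i"
      using p0(1) by (auto simp: mem_orbit_diagonal same_orbit_def)
    \<comment> \<open>As a polynomial in the first \<open>m\<close> entries, \<open>J\<close> cannot
      see where the two tuples differ.\<close>
    have "J (\<lambda>i. g (p0 i)) = J u"
      using J(1) by induction (use g in \<open>auto simp: tuple_coords_def\<close>)
    then show ?thesis using inv[OF g(1)] by simp
  qed
  note const = this
  \<comment> \<open>At least one of \<open>p\<close>, \<open>q\<close> has a value different from
    \<open>J p0\<close>.\<close>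
  obtain q' where q': "q' \<in> plane_power m" "J q' \<noteq> J p0" using nonconst by metis
  obtain P where P: "\<And>z. f (tuple_line p0 q' z) = poly P z"
    using polyfuns_tuple_line[of f m p0 q'] f(1) F(1) by blast
  obtain Q where Q: "\<And>z. J (tuple_line p0 q' z) = poly Q z" using polyfuns_tuple_line[OF J(1), of p0 q'] by blast
  have "poly (P * (Q - [:J p0:])) z = 0" for z
    using const[OF tuple_line_mem[OF p0(1) q'(1), of z]] by (auto simp: P Q)
  then have "P * (Q - [:J p0:]) = 0" using poly_all_0_iff_0 by blast
  moreover have "P \<noteq> 0" using P[of 0] f(2) by auto
  moreover have "Q - [:J p0:] \<noteq> 0" using Q[of 1] q'(2) by auto
  ultimately show False by simp
qed

lemma not_generically_infinitely_transitive_shears: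
  assumes "r * s < 2"
  shows "\<not> generically_infinitely_transitive (G_shears r s) (\<lambda>g. g)"
proof -
  consider "r = 0" | "s = 0" | "r = 1" "s = 1"
    using assms by (metis One_nat_def less_2_cases_iff mult_eq_0_iff nat_mult_eq_1_iff)
  then show ?thesis
  proof cases
    case 1
    \<comment> \<open>The first family consists of translations in \<open>x\<close>, and the second
      fixes \<open>x\<close>.\<close>
    let ?J = "\<lambda>p::nat \<Rightarrow> plane. fst (p 0) - fst (p 1)"
    show ?thesis
    proof (rule not_generically_infinitely_transitive_if_invariant[where J = ?J and m = 2 and
          p = "\<lambda>i\<in>{..<2}. (0, 0)" and q = "\<lambda>i\<in>{..<2}. (of_nat i, 0)"])
      show "?J \<in> polyfuns (tuple_coords 2)"
        by (intro polyfuns_diff polyfuns.coord) (auto simp: tuple_coords_def)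
    qed (auto simp: 1 plane_power_def case_prod_beta' algebra_simps)
  next
    case 2
    let ?J = "\<lambda>p::nat \<Rightarrow> plane. snd (p 0) - snd (p 1)"
    show ?thesis
    proof (rule not_generically_infinitely_transitive_if_invariant[where J = ?J and m = 2 and
          p = "\<lambda>i\<in>{..<2}. (0, 0)" and q = "\<lambda>i\<in>{..<2}. (0, of_nat i)"])
      show "?J \<in> polyfuns (tuple_coords 2)"
        by (intro polyfuns_diff polyfuns.coord) (auto simp: tuple_coords_def)
    qed (auto simp: 2 plane_power_def case_prod_beta' algebra_simps)
  next
    case 3
    \<comment> \<open>Both families are linear of determinant 1, so they preserve the determinant of
      a pair of vectors; the witnesses have determinants 0 and 1.\<close>
    let ?J = "\<lambda>p::nat \<Rightarrow> plane. fst (p 0) * snd (p 1) - fst (p 1) * snd (p 0)"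
    show ?thesis
    proof (rule not_generically_infinitely_transitive_if_invariant[where J = ?J and m = 2 and
          p = "\<lambda>i\<in>{..<2}. (0, 0)" and q = "\<lambda>i\<in>{..<2}. (1, of_nat i)"])
      show "?J \<in> polyfuns (tuple_coords 2)"
        by (intro polyfuns_diff polyfuns.mult polyfuns.coord) (auto simp: tuple_coords_def)
    qed (auto simp: 3 plane_power_def case_prod_beta' algebra_simps)
  qed
qed

theorem theorem18:
  fixes r s :: nat
  shows "generically_infinitely_transitive (G_shears r s) (\<lambda>g. g) \<longleftrightarrow> r * s \<ge> 2"
proof
  show "r * s \<ge> 2" if "generically_infinitely_transitive (G_shears r s) (\<lambda>g. g)"
    using not_generically_infinitely_transitive_shears[of r s] that by (cases "r * s < 2") simp_all
qed (rule generically_infinitely_transitive_shears)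

end
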